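(* Let $Q$ be a Buchsteiner loop and let $x,y,z \in Q$. Put $u = [x,y^{-1},z]$, $s_x = [x^2,y,z]$, $s_y = [y^2,z,x]$ and $s_z = [z^2,y,x]$. Then $s_x = u^x u$, $s_y = u^y u$ and $s_z = u^z u$. Furthermore, $$ s_x s_y s_z = 1,\qquad u^x u^y u^z = u^{-3},\qquad u^{xyz} = u^{-1},\qquad (u^2)^x = (u^2)^y = (u^2)^z = u^{-2}.$$
   Context: A Buchsteiner loop is a loop $Q$ satisfying $x\backslash (xy\cdot z) = (y\cdot zx)/x$ for all $x,y,z$, where $\backslash$ and $/$ are left and right division. The nucleus $N=N(Q)$ is the set of all $a$ such that $a(xy)=(ax)y$, $x(ay)=(xa)y$ and $x(ya)=(xy)a$ for all $x,y\in Q$. The associator is $[x,y,z] = (x\cdot yz)\backslash(xy\cdot z)$. $A(Q)$ is the least normal subloop $A$ such that $Q/A$ is a group. In a Buchsteiner loop $N$ is a normal subloop, $Q/N$ is an abelian group of exponent dividing $4$, and all associators lie in the abelian group $A(Q)\le Z(N)$. For $n\in N$ and $v\in Q$, $n^v = v\backslash(nv)\in N$; this induces a right action of the group $Q/A(Q)$ on $N$, so $n^{xy}=(n^x)^y$. The value of $[x,y,z]$ depends only on the cosets $xN,yN,zN$; $y^{-1}$ denotes an inverse of $y$ (it makes no difference for the associator which one-sided inverse is used). *)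

theory Defs
  imports "HOL-Algebra.Group"
begin

text \<open>
  Loops are carried by the \<open>monoid\<close> record of HOL-Algebra, of which only the signature
  (carrier, product, unit) is used. The library's \<open>inv\<^bsub>Q\<^esub>\<close> (the two-sided inverse) and
  the powers \<open>[^]\<^bsub>Q\<^esub>\<close> are thereby available as well; the theorem applies them only to
  associators, which in a Buchsteiner loop lie in the nucleus.
\<close>

locale loop =
  fixes Q :: "('a, 'b) monoid_scheme" (structure)
  assumes m_closed: "\<lbrakk>x \<in> carrier Q; y \<in> carrier Q\<rbrakk> \<Longrightarrow> x \<otimes> y \<in> carrier Q"
    and one_closed: "\<one> \<in> carrier Q"
    and l_one: "x \<in> carrier Q \<Longrightarrow> \<one> \<otimes> x = x"
    and r_one: "x \<in> carrier Q \<Longrightarrow> x \<otimes> \<one> = x"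
    and ldiv_ex1: "\<lbrakk>a \<in> carrier Q; b \<in> carrier Q\<rbrakk> \<Longrightarrow> \<exists>!x. x \<in> carrier Q \<and> a \<otimes> x = b"
    and rdiv_ex1: "\<lbrakk>a \<in> carrier Q; b \<in> carrier Q\<rbrakk> \<Longrightarrow> \<exists>!x. x \<in> carrier Q \<and> x \<otimes> a = b"

text \<open>\<open>ldiv Q a b\<close> is \<open>a\b\<close>, and \<open>rdiv Q b a\<close> is \<open>b/a\<close>.\<close>

definition ldiv :: "('a, 'b) monoid_scheme \<Rightarrow> 'a \<Rightarrow> 'a \<Rightarrow> 'a" where
  "ldiv Q a b = (THE x. x \<in> carrier Q \<and> a \<otimes>\<^bsub>Q\<^esub> x = b)"

definition rdiv :: "('a, 'b) monoid_scheme \<Rightarrow> 'a \<Rightarrow> 'a \<Rightarrow> 'a" where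
  "rdiv Q b a = (THE x. x \<in> carrier Q \<and> x \<otimes>\<^bsub>Q\<^esub> a = b)"

locale buchsteiner_loop = loop +
  assumes buchsteiner:
    "\<lbrakk>x \<in> carrier Q; y \<in> carrier Q; z \<in> carrier Q\<rbrakk> \<Longrightarrow>
      ldiv Q x ((x \<otimes> y) \<otimes> z) = rdiv Q (y \<otimes> (z \<otimes> x)) x"

definition associator :: "('a, 'b) monoid_scheme \<Rightarrow> 'a \<Rightarrow> 'a \<Rightarrow> 'a \<Rightarrow> 'a" where
  "associator Q x y z =
    ldiv Q (x \<otimes>\<^bsub>Q\<^esub> (y \<otimes>\<^bsub>Q\<^esub> z)) ((x \<otimes>\<^bsub>Q\<^esub> y) \<otimes>\<^bsub>Q\<^esub> z)"

text \<open>\<open>conj_by Q n v\<close> is \<open>n\<^sup>v\<close>; it is meant for \<open>n\<close> in the nucleus.\<close>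

definition conj_by :: "('a, 'b) monoid_scheme \<Rightarrow> 'a \<Rightarrow> 'a \<Rightarrow> 'a" where
  "conj_by Q n v = ldiv Q v (n \<otimes>\<^bsub>Q\<^esub> v)"

text \<open>One-sided inverses need not coincide in a Buchsteiner loop; this covers both.\<close>

definition one_sided_inverse :: "('a, 'b) monoid_scheme \<Rightarrow> 'a \<Rightarrow> 'a \<Rightarrow> bool" where
  "one_sided_inverse Q y y' \<longleftrightarrow>
    y' \<in> carrier Q \<and> (y' \<otimes>\<^bsub>Q\<^esub> y = \<one>\<^bsub>Q\<^esub> \<or> y \<otimes>\<^bsub>Q\<^esub> y' = \<one>\<^bsub>Q\<^esub>)"

end

theory Submission
  imports Defs
begin

text \<open>
  Write \<open>L\<^sub>x\<close> and \<open>R\<^sub>x\<close> for the left and right translations. The Buchsteiner law says exactly that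
  \<open>(L\<^sub>x, R\<^sub>x\<^sup>-\<^sup>1, L\<^sub>x R\<^sub>x\<^sup>-\<^sup>1)\<close> is an autotopism for every \<open>x\<close>; it also lets an equation between
  products of three factors be turned cyclically. The structure theory of Buchsteiner loops that the
  identities rest on is derived from these two forms of the law.

  The first goal is to find nuclear elements. The element \<open>\<eta>(x)\<close>, the right inverse of \<open>x\<close> times \<open>x\<close>, measures how far the
  inverses of \<open>x\<close> are from coinciding; a computation with words in \<open>L\<^sub>x\<close> and \<open>R\<^sub>x\<close> shows that it is nuclear
  (\<open>eta_nuclear\<close>). Hence the weak inverse property holds up to nuclear factors, and this makes the left inner
  mappings \<open>L\<^bsub>xy\<^esub>\<^sup>-\<^sup>1 L\<^sub>x L\<^sub>y\<close> automorphisms (\<open>automorphism_inner\<close>). Finally an element whose conjugation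
  is an automorphism is nuclear (\<open>nuclear_if_conj_automorphism\<close>), and associators are such elements
  (\<open>associator_nuclear\<close>).

  Since replacing \<open>z\<close> by \<open>zn\<close> with \<open>n\<close> nuclear both conjugates \<open>[x,y,z]\<close> by \<open>n\<close> and leaves it fixed, associators
  are central in the nucleus (\<open>associator_central\<close>). On this abelian group, written additively here, \<open>Q\<close> acts on
  the right by conjugation, and \<open>f(x,y,z) = [x,y,z]\<close> satisfies the cyclic law \<open>f(y,z,x) = - f(x,y,z) x\<close>, is a
  crossed homomorphism in the third slot (the inner mapping of \<open>x\<close> and \<open>y\<close> being an automorphism), hence
  in every slot, and obeys the associator cocycle identity. Together these force
  \<open>f(xy,z,w) = f(yx,z,w)\<close>: commutators are nuclear and the action is commutative.

  Now let \<open>p = f(x,z,w)\<close> and \<open>A = p - p v\<close>. The identities collected so far give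
  \<open>A x = A z = A w = A v = - A\<close>. Therefore \<open>v\<^sup>2\<close> fixes every associator (\<open>act_square\<close>), and
  \<open>p (1 - v) (1 + t) = 0\<close> for each argument \<open>t\<close> of \<open>p\<close> (\<open>asc_anti\<close>). In the situation of the theorem put
  \<open>p = f(x,y,z)\<close> and \<open>a = p\<close>, \<open>b = p x\<close>, \<open>c = p y\<close>, \<open>d = p z\<close>. By the cyclic law \<open>xyz\<close> acts on \<open>p\<close> as \<open>-1\<close>, and
  squares act trivially, so the three elements permute the elements \<open>a, b, c, d\<close> up to sign; \<open>u = - c\<close>; and the vanishing products
  give \<open>a + b = c - d = d - c\<close>, \<open>a + c = b - d = d - b\<close>, \<open>a + d = b - c = c - b\<close>. The associators \<open>s\<^sub>x\<close> and \<open>s\<^sub>y\<close> are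
  read off from the crossed homomorphism rule, \<open>s\<^sub>z\<close> needs in addition that \<open>f(x,y,z)\<close> and \<open>f(z,y,x)\<close> differ by a
  fixed element of order at most two (\<open>asc_reverse\<close>). All the identities are then consequences of these linear relations.
\<close>

section \<open>The group of permutations of a type\<close>

text \<open>
  Permutations are written additively, with \<open>f + g\<close> for the composite \<open>f \<circ> g\<close>, because \<open>group_add\<close> is a class of
  groups that need not be commutative: identities between words in translations can then be
  checked by rewriting.
\<close>

typedef 'a symm = "{f :: 'a \<Rightarrow> 'a. bij f}" morphisms app Abs_symm
  by (rule exI[of _ id]) simp

setup_lifting type_definition_symm

instantiation symm :: (type) group_add
begin

lift_definition zero_symm :: "'a symm" is id by simp
lift_definition plus_symm :: "'a symm \<Rightarrow> 'a symm \<Rightarrow> 'a symm" is "\<lambda>f g. f \<circ> g" by (simp add: bij_comp)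
lift_definition uminus_symm :: "'a symm \<Rightarrow> 'a symm" is "inv_into UNIV" by (simp add: bij_imp_bij_inv)
definition minus_symm :: "'a symm \<Rightarrow> 'a symm \<Rightarrow> 'a symm" where "minus_symm f g = f + - g"

instance
proof
  fix a b c :: "'a symm"
  show "a + b + c = a + (b + c)" by transfer (simp add: comp_assoc)
  show "0 + a = a" by transfer simp
  show "a + 0 = a" by transfer simp
  show "- a + a = 0" by transfer (simp add: bij_is_inj)
  show "a + - b = a - b" by (simp add: minus_symm_def)
qed

end

lemma app_add [simp]: "app (f + g) y = app f (app g y)" by transfer simp
lemma app_zero [simp]: "app 0 y = y" by transfer simp
lemma app_uminus_app [simp]: "app (- f) (app f y) = y" "app f (app (- f) y) = y"
  by (metis app_add app_zero left_minus, metis app_add app_zero right_minus)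
lemma app_diff [simp]: "app (f - g) y = app f (app (- g) y)"
  by (metis app_add add_uminus_conv_diff)
lemma symm_eqI: "(\<And>y. app f y = app g y) \<Longrightarrow> f = g"
  by (rule app_inject[THEN iffD1], rule ext)
lemma app_uminus_eq: "app (- f) y = z \<longleftrightarrow> y = app f z" by (metis app_uminus_app)

text \<open>
  Rewriting with these rules computes reduced words in a free group.
\<close>

lemmas word = add.assoc minus_add minus_minus add_minus_cancel minus_add_cancel
  right_minus left_minus add_0_left add_0_right minus_zero

lemma commute_uminus: assumes "a + b = b + a" shows "a + - b = - b + (a::'c::group_add)"
proof -
  have "a + - b = - b + (b + a) + - b" by (simp only: word)
  also have "\<dots> = - b + (a + b) + - b" by (simp only: assms)
  also have "\<dots> = - b + a" by (simp only: word)
  finally show ?thesis .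
qed

section \<open>Translations and autotopisms of a loop\<close>

context loop
begin

declare m_closed [simp] one_closed [simp] l_one [simp] r_one [simp]

lemma ldiv_props: assumes "a \<in> carrier Q" "b \<in> carrier Q"
  shows "ldiv Q a b \<in> carrier Q" "a \<otimes> ldiv Q a b = b"
  using theI'[OF ldiv_ex1[OF assms]] unfolding ldiv_def by auto

lemma rdiv_props: assumes "a \<in> carrier Q" "b \<in> carrier Q"
  shows "rdiv Q b a \<in> carrier Q" "rdiv Q b a \<otimes> a = b"
  using theI'[OF rdiv_ex1[OF assms]] unfolding rdiv_def by auto

declare ldiv_props [simp] rdiv_props [simp]

lemma l_cancel: "\<lbrakk>a \<otimes> b = a \<otimes> c; a \<in> carrier Q; b \<in> carrier Q; c \<in> carrier Q\<rbrakk> \<Longrightarrow> b = c"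
  using ldiv_ex1[of a "a \<otimes> c"] by auto

lemma r_cancel: "\<lbrakk>b \<otimes> a = c \<otimes> a; a \<in> carrier Q; b \<in> carrier Q; c \<in> carrier Q\<rbrakk> \<Longrightarrow> b = c"
  using rdiv_ex1[of a "c \<otimes> a"] by auto

lemma ldiv_mult [simp]: "\<lbrakk>a \<in> carrier Q; b \<in> carrier Q\<rbrakk> \<Longrightarrow> ldiv Q a (a \<otimes> b) = b"
  by (rule l_cancel) auto

lemma rdiv_mult [simp]: "\<lbrakk>a \<in> carrier Q; b \<in> carrier Q\<rbrakk> \<Longrightarrow> rdiv Q (b \<otimes> a) a = b"
  by (rule r_cancel) auto

lemma ldiv_self [simp]: "a \<in> carrier Q \<Longrightarrow> ldiv Q a a = \<one>"
  using ldiv_mult[of a \<one>] by simp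

lemma rdiv_self [simp]: "a \<in> carrier Q \<Longrightarrow> rdiv Q a a = \<one>"
  using rdiv_mult[of a \<one>] by simp

definition L :: "'a \<Rightarrow> 'a symm"
  where "L x = Abs_symm (\<lambda>y. if y \<in> carrier Q then x \<otimes> y else y)"

definition R :: "'a \<Rightarrow> 'a symm"
  where "R x = Abs_symm (\<lambda>y. if y \<in> carrier Q then y \<otimes> x else y)"

lemma bij_extend:
  assumes "\<And>y. y \<in> A \<Longrightarrow> f y \<in> A" "\<And>y. y \<in> A \<Longrightarrow> g y \<in> A"
    and "\<And>y. y \<in> A \<Longrightarrow> g (f y) = y" "\<And>y. y \<in> A \<Longrightarrow> f (g y) = y"
  shows "bij (\<lambda>y. if y \<in> A then f y else y)"
  by (rule o_bij[of "\<lambda>y. if y \<in> A then g y else y"]) (auto simp: fun_eq_iff assms)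

lemma app_L: "x \<in> carrier Q \<Longrightarrow> app (L x) y = (if y \<in> carrier Q then x \<otimes> y else y)"
  unfolding L_def by (subst Abs_symm_inverse) (auto intro!: bij_extend[of _ _ "ldiv Q x"])

lemma app_R: "x \<in> carrier Q \<Longrightarrow> app (R x) y = (if y \<in> carrier Q then y \<otimes> x else y)"
  unfolding R_def by (subst Abs_symm_inverse) (auto intro!: bij_extend[of _ _ "\<lambda>y. rdiv Q y x"])

text \<open>
  The permutations of the carrier, extended by the identity, so that equality of two of them can be tested
  on the carrier alone.
\<close>

definition Sym :: "'a symm set"
  where "Sym = {g. (\<forall>y\<in>carrier Q. app g y \<in> carrier Q) \<and> (\<forall>y. y \<notin> carrier Q \<longrightarrow> app g y = y)}"

lemma Sym_closed: "\<lbrakk>g \<in> Sym; y \<in> carrier Q\<rbrakk> \<Longrightarrow> app g y \<in> carrier Q"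
  by (simp add: Sym_def)

lemma Sym_zero [simp]: "0 \<in> Sym" by (simp add: Sym_def)
lemma Sym_add [simp]: "\<lbrakk>g \<in> Sym; h \<in> Sym\<rbrakk> \<Longrightarrow> g + h \<in> Sym" by (simp add: Sym_def)
lemma Sym_uminus [simp]: assumes g: "g \<in> Sym" shows "- g \<in> Sym"
proof -
  have out: "app (- g) y = y" if "y \<notin> carrier Q" for y
    using g that app_uminus_app(1)[of g y] by (simp add: Sym_def)
  have "app (- g) y \<in> carrier Q" if y: "y \<in> carrier Q" for y
  proof (rule ccontr)
    assume n: "app (- g) y \<notin> carrier Q"
    then have "app g (app (- g) y) = app (- g) y" using g unfolding Sym_def by blast
    then show False using n y by simp
  qed
  with out show ?thesis by (simp add: Sym_def)
qed
lemma Sym_diff [simp]: "\<lbrakk>g \<in> Sym; h \<in> Sym\<rbrakk> \<Longrightarrow> g - h \<in> Sym"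
  using Sym_add[of g "- h"] by simp
lemma L_Sym [simp]: "x \<in> carrier Q \<Longrightarrow> L x \<in> Sym" by (simp add: Sym_def app_L)
lemma R_Sym [simp]: "x \<in> carrier Q \<Longrightarrow> R x \<in> Sym" by (simp add: Sym_def app_R)

lemma Sym_eqI: assumes "g \<in> Sym" "h \<in> Sym" "\<And>y. y \<in> carrier Q \<Longrightarrow> app g y = app h y"
  shows "g = h"
proof (rule symm_eqI)
  fix y show "app g y = app h y" using assms by (cases "y \<in> carrier Q") (simp_all add: Sym_def)
qed

declare Sym_closed [simp]

lemma L_app [simp]: "\<lbrakk>x \<in> carrier Q; y \<in> carrier Q\<rbrakk> \<Longrightarrow> app (L x) y = x \<otimes> y" by (simp add: app_L)
lemma R_app [simp]: "\<lbrakk>x \<in> carrier Q; y \<in> carrier Q\<rbrakk> \<Longrightarrow> app (R x) y = y \<otimes> x" by (simp add: app_R)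

lemma L_uminus_app [simp]: "\<lbrakk>x \<in> carrier Q; y \<in> carrier Q\<rbrakk> \<Longrightarrow> app (- L x) y = ldiv Q x y"
  by (simp add: app_uminus_eq)
lemma R_uminus_app [simp]: "\<lbrakk>x \<in> carrier Q; y \<in> carrier Q\<rbrakk> \<Longrightarrow> app (- R x) y = rdiv Q y x"
  by (simp add: app_uminus_eq)

lemma L_one [simp]: "L \<one> = 0" by (rule Sym_eqI) auto
lemma R_one [simp]: "R \<one> = 0" by (rule Sym_eqI) auto

definition autotopism :: "'a symm \<Rightarrow> 'a symm \<Rightarrow> 'a symm \<Rightarrow> bool" where
  "autotopism f g h \<longleftrightarrow> f \<in> Sym \<and> g \<in> Sym \<and> h \<in> Sym \<and>
    (\<forall>a\<in>carrier Q. \<forall>b\<in>carrier Q. app f a \<otimes> app g b = app h (a \<otimes> b))"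

lemma autotopism_add: "\<lbrakk>autotopism f g h; autotopism f' g' h'\<rbrakk> \<Longrightarrow> autotopism (f + f') (g + g') (h + h')"
  by (auto simp: autotopism_def)

lemma autotopism_uminus: assumes "autotopism f g h" shows "autotopism (- f) (- g) (- h)"
  unfolding autotopism_def
proof (intro conjI ballI)
  fix a b assume ab: "a \<in> carrier Q" "b \<in> carrier Q"
  have "f \<in> Sym" "g \<in> Sym" using assms by (auto simp: autotopism_def)
  then have "app f (app (- f) a) \<otimes> app g (app (- g) b) = app h (app (- f) a \<otimes> app (- g) b)"
    using assms ab unfolding autotopism_def by (metis Sym_closed Sym_uminus)
  then show "app (- f) a \<otimes> app (- g) b = app (- h) (a \<otimes> b)"
    by simp
qed (use assms in \<open>auto simp: autotopism_def\<close>)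

definition automorphism :: "'a symm \<Rightarrow> bool" where "automorphism f \<longleftrightarrow> autotopism f f f"

lemma automorphism_zero: "automorphism 0" by (simp add: automorphism_def autotopism_def)
lemma automorphism_add: "\<lbrakk>automorphism f; automorphism g\<rbrakk> \<Longrightarrow> automorphism (f + g)" by (simp add: automorphism_def autotopism_add)
lemma automorphism_uminus: "automorphism f \<Longrightarrow> automorphism (- f)" by (simp add: automorphism_def autotopism_uminus)
lemma automorphism_Sym: "automorphism f \<Longrightarrow> f \<in> Sym" by (simp add: automorphism_def autotopism_def)
lemma automorphism_mult: "\<lbrakk>automorphism f; a \<in> carrier Q; b \<in> carrier Q\<rbrakk> \<Longrightarrow> app f (a \<otimes> b) = app f a \<otimes> app f b"
  by (simp add: automorphism_def autotopism_def)
lemma automorphism_one: assumes "automorphism f" shows "app f \<one> = \<one>"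
proof -
  have "app f \<one> \<otimes> app f \<one> = app f \<one> \<otimes> \<one>"
    using automorphism_mult[OF assms, of \<one> \<one>] automorphism_Sym[OF assms] by simp
  then show ?thesis by (rule l_cancel) (use automorphism_Sym[OF assms] in auto)
qed
lemma automorphism_L: "\<lbrakk>automorphism f; a \<in> carrier Q\<rbrakk> \<Longrightarrow> f + L a = L (app f a) + f"
  by (rule Sym_eqI) (auto simp: automorphism_Sym automorphism_mult)
lemma automorphism_R: "\<lbrakk>automorphism f; a \<in> carrier Q\<rbrakk> \<Longrightarrow> f + R a = R (app f a) + f"
  by (rule Sym_eqI) (auto simp: automorphism_Sym automorphism_mult)

text \<open>
  Evaluating an autotopism at \<open>\<one>\<close> in either argument expresses the other components by the first and by the value
  \<open>g \<one>\<close>, the companion of \<open>f\<close>.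
\<close>

lemma autotopism_fix_one: assumes "autotopism f g h" "app f \<one> = \<one>"
  shows "h = g" "b \<in> carrier Q \<Longrightarrow> app g b = app f b \<otimes> app g \<one>"
proof -
  have Sym: "f \<in> Sym" "g \<in> Sym" "h \<in> Sym" using assms by (auto simp: autotopism_def)
  show hg: "h = g"
  proof (rule Sym_eqI[OF Sym(3,2)])
    fix y assume "y \<in> carrier Q"
    then show "app h y = app g y" using assms Sym unfolding autotopism_def
      by (metis Sym_closed l_one one_closed)
  qed
  assume "b \<in> carrier Q"
  then show "app g b = app f b \<otimes> app g \<one>"
    using assms hg unfolding autotopism_def by (metis r_one one_closed)
qed

lemma autotopism_automorphism: assumes "autotopism f g h" "app f \<one> = \<one>" "app g \<one> = \<one>" shows "automorphism f"
proof -
  have Sym: "f \<in> Sym" "g \<in> Sym" "h \<in> Sym" using assms by (auto simp: autotopism_def)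
  have "g = f" by (rule Sym_eqI) (use autotopism_fix_one(2)[OF assms(1,2)] assms(3) Sym in auto)
  then show ?thesis using assms(1) autotopism_fix_one(1)[OF assms(1,2)] by (simp add: automorphism_def)
qed

end

section \<open>Two forms of the Buchsteiner law\<close>

context buchsteiner_loop
begin

lemma law_exchange: assumes "x \<in> carrier Q" "y \<in> carrier Q" "z \<in> carrier Q"
  shows "(x \<otimes> y) \<otimes> z = x \<otimes> rdiv Q (y \<otimes> (z \<otimes> x)) x"
  using buchsteiner[OF assms] assms by (metis ldiv_props(2) m_closed)

text \<open>
  The Buchsteiner law read as an equation between permutations, once in the argument \<open>z\<close> and once in the
  argument \<open>y\<close>. It writes the translations by a product as words in the translations by the factors.
\<close>

lemma law_L: assumes "x \<in> carrier Q" "y \<in> carrier Q"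
  shows "L (x \<otimes> y) = L x + - R x + L y + R x"
  by (rule Sym_eqI) (use assms law_exchange in auto)

lemma law_R: assumes "x \<in> carrier Q" "y \<in> carrier Q"
  shows "R (y \<otimes> x) = R x + - L x + R y + L x"
proof (rule Sym_eqI)
  fix z assume "z \<in> carrier Q"
  then show "app (R (y \<otimes> x)) z = app (R x + - L x + R y + L x) z"
    using assms buchsteiner[of x z y] by simp
qed (use assms in auto)

lemma autotopism_B: "x \<in> carrier Q \<Longrightarrow> autotopism (L x) (- R x) (L x + - R x)"
  using law_exchange unfolding autotopism_def by auto

text \<open>
  The left side of the Buchsteiner law is a function of \<open>(x y) z\<close> and \<open>x\<close>, the right side the same kind of
  function of \<open>y (z x)\<close> and \<open>x\<close>. So an equation between products of the first form is equivalent to the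
  equation between the products obtained by moving \<open>x\<close> from the front to the end.
\<close>

lemma cyc: assumes "(y \<otimes> b) \<otimes> a = (y \<otimes> d) \<otimes> c"
    and "a \<in> carrier Q" "b \<in> carrier Q" "c \<in> carrier Q" "d \<in> carrier Q" "y \<in> carrier Q"
  shows "b \<otimes> (a \<otimes> y) = d \<otimes> (c \<otimes> y)"
proof -
  have "rdiv Q (b \<otimes> (a \<otimes> y)) y = rdiv Q (d \<otimes> (c \<otimes> y)) y"
    using assms buchsteiner[of y b a] buchsteiner[of y d c] by simp
  then have "rdiv Q (b \<otimes> (a \<otimes> y)) y \<otimes> y = rdiv Q (d \<otimes> (c \<otimes> y)) y \<otimes> y"
    by (rule arg_cong)
  then show ?thesis using assms(2-) by simp
qed

lemma cyc': assumes "b \<otimes> (a \<otimes> y) = d \<otimes> (c \<otimes> y)"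
    and "a \<in> carrier Q" "b \<in> carrier Q" "c \<in> carrier Q" "d \<in> carrier Q" "y \<in> carrier Q"
  shows "(y \<otimes> b) \<otimes> a = (y \<otimes> d) \<otimes> c"
proof -
  have "ldiv Q y ((y \<otimes> b) \<otimes> a) = ldiv Q y ((y \<otimes> d) \<otimes> c)"
    using assms buchsteiner[of y b a] buchsteiner[of y d c] by simp
  then have "y \<otimes> ldiv Q y ((y \<otimes> b) \<otimes> a) = y \<otimes> ldiv Q y ((y \<otimes> d) \<otimes> c)"
    by (rule arg_cong)
  then show ?thesis using assms(2-) by simp
qed

lemma cyc_RL: assumes "R a + R b = R c + R d"
    "a \<in> carrier Q" "b \<in> carrier Q" "c \<in> carrier Q" "d \<in> carrier Q"
  shows "L b + L a = L d + L c"
proof (rule Sym_eqI)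
  fix y assume y: "y \<in> carrier Q"
  have "(y \<otimes> b) \<otimes> a = (y \<otimes> d) \<otimes> c"
    using arg_cong[OF assms(1), of "\<lambda>g. app g y"] assms(2-) y by simp
  then show "app (L b + L a) y = app (L d + L c) y"
    using cyc[of y b a d c] assms(2-) y by simp
qed (use assms in auto)

lemma cyc_LR: assumes "L b + L a = L d + L c"
    "a \<in> carrier Q" "b \<in> carrier Q" "c \<in> carrier Q" "d \<in> carrier Q"
  shows "R a + R b = R c + R d"
proof (rule Sym_eqI)
  fix y assume y: "y \<in> carrier Q"
  have "b \<otimes> (a \<otimes> y) = d \<otimes> (c \<otimes> y)"
    using arg_cong[OF assms(1), of "\<lambda>g. app g y"] assms(2-) y by simp
  then show "app (R a + R b) y = app (R c + R d) y"
    using cyc'[of b a y d c] assms(2-) y by simp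
qed (use assms in auto)

text \<open>
  Consequently a triple associates if and only if its cyclic rotations do, and the left, middle and right
  nucleus coincide.
\<close>

lemma assoc_cyc:
  assumes "(x \<otimes> y) \<otimes> z = x \<otimes> (y \<otimes> z)"
    and "x \<in> carrier Q" "y \<in> carrier Q" "z \<in> carrier Q"
  shows "(y \<otimes> z) \<otimes> x = y \<otimes> (z \<otimes> x)"
  using cyc[of x y z "y \<otimes> z" \<one>] assms by simp

section \<open>The nucleus\<close>

text \<open>
  The middle nucleus. It is the nucleus by \<open>N_left\<close> and \<open>N_right\<close>.
\<close>

definition N :: "'a set" where
  "N = {n \<in> carrier Q. \<forall>x\<in>carrier Q. \<forall>y\<in>carrier Q. (x \<otimes> n) \<otimes> y = x \<otimes> (n \<otimes> y)}"

lemma N_carrier: "n \<in> N \<Longrightarrow> n \<in> carrier Q" by (simp add: N_def)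

lemma N_mid: "\<lbrakk>n \<in> N; x \<in> carrier Q; y \<in> carrier Q\<rbrakk> \<Longrightarrow> (x \<otimes> n) \<otimes> y = x \<otimes> (n \<otimes> y)"
  by (simp add: N_def)

declare N_carrier [simp]

lemma N_left: "\<lbrakk>n \<in> N; x \<in> carrier Q; y \<in> carrier Q\<rbrakk> \<Longrightarrow> (n \<otimes> x) \<otimes> y = n \<otimes> (x \<otimes> y)"
  using assoc_cyc[of y n x] N_mid[of n y x] by simp

lemma N_right: "\<lbrakk>n \<in> N; x \<in> carrier Q; y \<in> carrier Q\<rbrakk> \<Longrightarrow> (x \<otimes> y) \<otimes> n = x \<otimes> (y \<otimes> n)"
  using assoc_cyc[of n x y] N_left[of n x y] by simp

lemma N_leftI:
  assumes n: "n \<in> carrier Q"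
    and "\<And>x y. \<lbrakk>x \<in> carrier Q; y \<in> carrier Q\<rbrakk> \<Longrightarrow> (n \<otimes> x) \<otimes> y = n \<otimes> (x \<otimes> y)"
  shows "n \<in> N"
proof -
  have "(x \<otimes> n) \<otimes> y = x \<otimes> (n \<otimes> y)" if "x \<in> carrier Q" "y \<in> carrier Q" for x y
    using assoc_cyc[OF assoc_cyc, of n y x] assms that by simp
  with n show ?thesis unfolding N_def by blast
qed

section \<open>One-sided inverses\<close>

abbreviation rinv where "rinv x \<equiv> ldiv Q x \<one>"
abbreviation linv where "linv x \<equiv> rdiv Q \<one> x"

lemma rinv_linv [simp]: "x \<in> carrier Q \<Longrightarrow> rinv (linv x) = x"
  by (rule l_cancel[of "linv x"]) auto
lemma linv_rinv [simp]: "x \<in> carrier Q \<Longrightarrow> linv (rinv x) = x"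
  by (rule r_cancel[of _ "rinv x"]) auto

text \<open>
  By the law, \<open>E x\<close> is the product of \<open>L\<^sub>x\<close> with the left translation by the right inverse of \<open>x\<close>, and also the product of
  the left translation by the left inverse of \<open>x\<close> with \<open>L\<^sub>x\<close>. It measures the failure of the inverse properties.
\<close>

definition E :: "'a \<Rightarrow> 'a symm" where "E x = L x + R x + - L x + - R x"

lemma E_Sym [simp]: "x \<in> carrier Q \<Longrightarrow> E x \<in> Sym" unfolding E_def by (intro Sym_add Sym_uminus) auto

text \<open>
  Each of the four words for translations by inverses results from the law for a product equal to \<open>\<one>\<close>, solved
  for the translation by the inverse.
\<close>

lemma L_rinv: assumes "x \<in> carrier Q" shows "L (rinv x) = - L x + E x"
proof -
  have "L (rinv x) = R x + - L x + (L x + - R x + L (rinv x) + R x) + - R x"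
    by (simp only: word)
  also have "\<dots> = R x + - L x + - R x" using law_L[of x "rinv x"] assms by simp
  finally show ?thesis by (simp only: E_def word)
qed

lemma R_linv: assumes "x \<in> carrier Q" shows "R (linv x) = - R x + - E x"
proof -
  have "R (linv x) = L x + - R x + (R x + - L x + R (linv x) + L x) + - L x"
    by (simp only: word)
  also have "\<dots> = L x + - R x + - L x" using law_R[of x "linv x"] assms by simp
  finally show ?thesis by (simp only: E_def word)
qed

lemma L_linv: assumes "x \<in> carrier Q" shows "L (linv x) = E x + - L x"
proof -
  have "L (linv x) = (L (linv x) + - R (linv x) + L x + R (linv x)) + - R (linv x) + - L x + R (linv x)"
    by (simp only: word)
  also have "\<dots> = - R (linv x) + - L x + R (linv x)" using law_L[of "linv x" x] assms by simp
  finally show ?thesis using assms by (simp only: R_linv E_def word)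
qed

lemma R_rinv: assumes "x \<in> carrier Q" shows "R (rinv x) = - E x + - R x"
proof -
  have "R (rinv x) = (R (rinv x) + - L (rinv x) + R x + L (rinv x)) + - L (rinv x) + - R x + L (rinv x)"
    by (simp only: word)
  also have "\<dots> = - L (rinv x) + - R x + L (rinv x)" using law_R[of "rinv x" x] assms by simp
  finally show ?thesis using assms by (simp only: L_rinv E_def word)
qed

lemma E_linv: assumes "x \<in> carrier Q" shows "E (linv x) = E x"
proof -
  have "E (linv x) = L (linv x) + (- L (linv x) + E (linv x))" by (simp only: word)
  also have "\<dots> = L (linv x) + L x" using L_rinv[of "linv x"] assms by simp
  also have "\<dots> = E x" using assms by (simp only: L_linv word)
  finally show ?thesis .
qed

text \<open>
  The autotopisms of \<open>x\<close> and of its right inverse multiply to an autotopism whose first two components are both \<open>E x\<close>.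
\<close>

lemma automorphism_E: assumes x: "x \<in> carrier Q" shows "automorphism (E x)"
proof -
  have "L x + L (rinv x) = E x" "- R x + - R (rinv x) = E x"
    using x by (simp_all only: L_rinv R_rinv word)
  then have "autotopism (E x) (E x) (L x + - R x + (L (rinv x) + - R (rinv x)))"
    using autotopism_add[OF autotopism_B[OF x] autotopism_B[of "rinv x"]] x by simp
  moreover have "app (E x) \<one> = \<one>"
    using arg_cong[OF \<open>L x + L (rinv x) = E x\<close>, of "\<lambda>g. app g \<one>"] x by simp
  ultimately show ?thesis by (blast intro: autotopism_automorphism)
qed

text \<open>
  Both \<open>E x\<close> and its inverse are automorphisms. Computing the translations by the image of \<open>x\<close> under
  each of them in two ways determines \<open>w = E x (x) \<cdot> x\<close> and \<open>w' = x \<cdot> (E x)\<^sup>-\<^sup>1(x)\<close> by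
  \<open>R\<^sub>w R\<^sub>x = R\<^sub>x R\<^sub>t\<close> and \<open>L\<^bsub>w'\<^esub> L\<^sub>x = L\<^sub>x L\<^sub>t\<close>, where \<open>t = x x\<close>. The law for the triple
  \<open>(x,x,x)\<close> says that \<open>w = w'\<close>. Turning the first equation cyclically gives a second expression for \<open>L\<^sub>w\<close>, and the
  comparison is the assertion.
\<close>

lemma E_commute_conj: assumes x: "x \<in> carrier Q"
  shows "E x + (R x + L x + L x + - R x) = (R x + L x + L x + - R x) + E x"
proof -
  define l r e t a b where "l = L x" "r = R x" "e = E x" "t = x \<otimes> x"
    and "a = app (E x) x" and "b = app (- E x) x"
  note defs = this
  have e: "e = l + r + - l + - r" by (simp only: defs E_def)
  have C [simp]: "t \<in> carrier Q" "a \<in> carrier Q" "b \<in> carrier Q" using x by (auto simp: defs)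
  have Lt: "L t = l + - r + l + r" using x by (simp add: defs law_L)
  have Rt: "R t = r + - l + r + l" using x by (simp add: defs law_R)
  have "R a = (R a + e) + - e" by (simp only: word)
  then have Ra: "R a = e + r + - e" using automorphism_R[OF automorphism_E[OF x] x] by (simp only: defs)
  have "L b = (L b + - e) + e" by (simp only: word)
  then have Lb: "L b = - e + l + e" using automorphism_L[OF automorphism_uminus[OF automorphism_E[OF x]] x] by (simp only: defs)
  have Rw: "R (a \<otimes> x) = r + - l + R a + l" using x by (simp add: defs law_R)
  have Lw: "L (x \<otimes> b) = l + - r + L b + r" using x by (simp add: defs law_L)
  \<comment> \<open>Here \<open>a x\<close> is \<open>w\<close> and \<open>x b\<close> is \<open>w'\<close>.\<close>
  have 1: "R (a \<otimes> x) + r = r + R t" by (simp only: Rw Ra Rt e word)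
  have 2: "L (x \<otimes> b) + l = l + L t" by (simp only: Lw Lb Lt e word)
  have "x \<otimes> (a \<otimes> x) = t \<otimes> x"
    using arg_cong[OF 1, of "\<lambda>g. app g \<one>"] x by (simp add: defs(2))
  moreover have "(x \<otimes> b) \<otimes> x = x \<otimes> t"
    using arg_cong[OF 2, of "\<lambda>g. app g \<one>"] x by (simp add: defs(1))
  moreover have "ldiv Q x (t \<otimes> x) = rdiv Q (x \<otimes> t) x" using buchsteiner[OF x x x] by (simp add: defs(4))
  ultimately have w: "a \<otimes> x = x \<otimes> b" using x C ldiv_mult[of x "a \<otimes> x"] rdiv_mult[of x "x \<otimes> b"] by simp
  have "l + L (a \<otimes> x) = L t + l"
    using cyc_RL[of "a \<otimes> x" x x t] 1 x by (simp add: defs(1,2))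
  then have 3: "l + (l + - r + L b + r) = L t + l" using w Lw by simp
  have "e + (r + l + l + - r) = r + - l + (L t + l) + - r" by (simp only: Lt e word)
  also have "\<dots> = r + - l + (l + (l + - r + L b + r)) + - r" by (simp only: 3)
  also have "\<dots> = (r + l + l + - r) + e" by (simp only: Lb e word)
  finally show ?thesis by (simp only: defs(1-3))
qed

lemma E_commute_rinv: assumes x: "x \<in> carrier Q"
  shows "E x + (L (rinv x) + L (rinv x)) = (L (rinv x) + L (rinv x)) + E x"
proof -
  have "L (rinv x) + L (rinv x) = - (R x + L x + L x + - R x)" using x by (simp only: L_rinv E_def word)
  then show ?thesis using commute_uminus[OF E_commute_conj[OF x]] by simp
qed

text \<open>
  \<open>E_commute_rinv\<close> at the left inverse of \<open>x\<close>, which has \<open>x\<close> as its right inverse and shares \<open>E x\<close>.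
\<close>

lemma E_commute_sq: assumes x: "x \<in> carrier Q" shows "E x + (L x + L x) = L x + L x + E x"
  using E_commute_rinv[of "linv x"] x by (simp add: E_linv)

text \<open>
  Commutation with the square of \<open>L\<^sub>x\<close> identifies two products of left translations, by \<open>x\<close> and its two inverses.
  Turned cyclically, this becomes an identity of right translations.
\<close>

lemma R_conj_E: assumes x: "x \<in> carrier Q" shows "R x + E x + - R x = - R x + E x + R x"
proof -
  have "L (rinv x) + L x = - L x + (E x + (L x + L x)) + - L x" using x by (simp only: L_rinv word)
  also have "\<dots> = L x + L (linv x)" using x by (simp only: E_commute_sq L_linv word)
  finally have "R x + R (rinv x) = R (linv x) + R x" using cyc_LR[of "rinv x" x x "linv x"] x by simp
  then have "R x + (- E x + - R x) = - R x + - E x + R x" using x by (simp only: R_rinv R_linv)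
  from arg_cong[OF this, of uminus] show ?thesis by (simp only: word)
qed

lemma eta_eq: assumes x: "x \<in> carrier Q" shows "rinv x \<otimes> x = x \<otimes> linv x"
proof -
  have "L (rinv x) + L x = - L x + (E x + (L x + L x)) + - L x" using x by (simp only: L_rinv word)
  also have "\<dots> = L x + L (linv x)" using x by (simp only: E_commute_sq L_linv word)
  finally show ?thesis using x by (metis L_app app_add ldiv_props(1) one_closed r_one rdiv_props(1))
qed

section \<open>The products of an element with its one-sided inverses\<close>

definition eta where "eta x = rinv x \<otimes> x"

text \<open>
  Put \<open>F = R\<^sub>x (E x) R\<^sub>x\<^sup>-\<^sup>1 = R\<^sub>x\<^sup>-\<^sup>1 (E x) R\<^sub>x\<close>. The two factorizations of \<open>h = \<eta>(x)\<close> give two words for \<open>L\<^sub>h\<close>,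
  whose equality means that \<open>E x\<close> and \<open>F\<close> commute. This makes the inner mapping of \<open>x, x\<close> an automorphism, and
  then \<open>L\<^sub>h L\<^sub>x\<close> is a left translation. By cyclic rotation \<open>R\<^sub>h\<close> commutes with \<open>L\<^sub>x\<close>, which simplifies \<open>R\<^sub>h\<close> to a word that
  occurs as the inverse of the first component in a product of known autotopisms. The third component of that product
  turns out to be the identity, and such an autotopism exhibits \<open>h\<close> as a middle nuclear element.
\<close>

lemma eta_nuclear: assumes x: "x \<in> carrier Q" shows "eta x \<in> N"
proof -
  define l r e t h F where "l = L x" "r = R x" "e = E x" "t = x \<otimes> x" "h = eta x"
    and "F = r + e + - r"
  note defs = this
  have e: "e = l + r + - l + - r" by (simp only: defs E_def)
  have C [simp]: "t \<in> carrier Q" "h \<in> carrier Q" using x by (auto simp: defs eta_def)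
  have Sym [simp]: "l \<in> Sym" "r \<in> Sym" "e \<in> Sym" "F \<in> Sym" using x by (auto simp: defs)
  have sq: "e + (l + l) = l + l + e" using E_commute_sq[OF x] by (simp only: defs)
  have G: "F = - r + e + r" using R_conj_E[OF x] by (simp only: defs)
  have Lt: "L t = l + F + l"
  proof -
    have "L t = l + - r + l + r" using x by (simp add: defs law_L)
    also have "\<dots> = l + F + l" by (simp only: G e word)
    finally show ?thesis .
  qed
  have Rt: "R t = r + - l + r + l" using x by (simp add: defs law_R)
  have Fl: "F + (l + l) = l + l + F"
  proof -
    have "F + (l + l) = - r + (e + (r + l + l + - r)) + r" by (simp only: G word)
    also have "\<dots> = - r + ((r + l + l + - r) + e) + r" using E_commute_conj[OF x] by (simp only: defs)
    also have "\<dots> = l + l + F" by (simp only: G word)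
    finally show ?thesis .
  qed
  have h: "h = x \<otimes> linv x" using eta_eq[OF x] by (simp only: defs eta_def)
  have Lh: "L h = l + F + - l + - F"
  proof -
    have "L h = l + - r + (e + - l) + r" using x by (simp only: h law_L rdiv_props one_closed L_linv defs)
    also have "\<dots> = l + (- r + e + r) + - l + - (- r + e + r)" by (simp only: e word)
    finally show ?thesis by (simp only: G[symmetric])
  qed
  have Lh2: "L h = - l + e + F + - e + l + - F"
  proof -
    have "L h = (- l + e) + - (- e + - r) + l + (- e + - r)"
      using x by (simp only: defs(5) eta_def law_L ldiv_props one_closed L_rinv R_rinv defs(1-3))
    also have "\<dots> = - l + e + F + - e + l + - F" by (simp only: F_def e word)
    finally show ?thesis .
  qed
  have eF: "e + F = F + e"
  proof -
    have "e + F + - e = l + (- l + e + F + - e + l + - F) + F + - l" by (simp only: word)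
    also have "\<dots> = l + (l + F + - l + - F) + F + - l" by (simp only: Lh Lh2[symmetric])
    also have "\<dots> = (F + (l + l)) + - l + - l" unfolding Fl by (simp only: word)
    also have "\<dots> = F" by (simp only: word)
    finally have "e + F + - e = F" .
    then show ?thesis by (metis add.assoc left_minus add_0_right)
  qed
  have xe: "app e \<one> = \<one>" using automorphism_one[OF automorphism_E[OF x]] by (simp only: defs)
  have lr1: "app l \<one> = x" "app r \<one> = x" using x by (simp_all add: defs)
  \<comment> \<open>The companion of the inner mapping of \<open>x, x\<close> is trivial.\<close>
  have c: "app (R t + (- r + - r)) \<one> = \<one>"
  proof -
    have "R t + (- r + - r) = r + - l + (- e + - (- r + e + r)) + - r + l" by (simp only: Rt e word)
    also have "\<dots> = r + - l + (- e + - F) + - r + l" by (simp only: G[symmetric])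
    also have "- e + - F = - F + - e" using arg_cong[OF eF, of uminus] by (simp only: minus_add)
    finally have "app (R t + (- r + - r)) \<one> = app (r + - l + (- F + - e)) (app (- r) (app l \<one>))"
      by simp
    also have "app (- r) (app l \<one>) = \<one>" using lr1 by (metis app_uminus_app(1))
    also have "app (r + - l + (- F + - e)) \<one> = app (r + - l) (app (- F) (app (- e) \<one>))" by simp
    also have "app (- e) \<one> = \<one>" using xe by (metis app_uminus_app(1))
    also have "app (- F) \<one> = app (- r + - e) (app r \<one>)" by (simp only: G word app_add)
    also have "\<dots> = x \<otimes> linv x" using R_linv[OF x] x lr1 by (metis R_app defs(2,3) one_closed rdiv_props(1))
    also have "app (r + - l) (x \<otimes> linv x) = \<one>" using x by (simp add: defs)
    finally show ?thesis .
  qed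
  \<comment> \<open>This is the inverse of the inner mapping of \<open>x, x\<close>.\<close>
  have autX: "automorphism (- l + F + l)"
  proof -
    have "autotopism (- L t + (l + l)) (- (- R t) + (- r + - r)) (- (L t + - R t) + (l + - r + (l + - r)))"
      unfolding defs(1,2) using x by (intro autotopism_add autotopism_uminus autotopism_B) auto
    moreover have "app (- L t + (l + l)) \<one> = \<one>"
      using x by (simp add: defs app_uminus_eq)
    ultimately have "automorphism (- L t + (l + l))" using c by (intro autotopism_automorphism) auto
    then have "automorphism (- (- L t + (l + l)))" by (rule automorphism_uminus)
    then show ?thesis by (simp only: Lt word)
  qed
  have hx: "L h + L x = L (h \<otimes> x)"
  proof -
    have "L (app (- l + F + l) x) = (- l + F + l) + l + - (- l + F + l)"
      using automorphism_L[OF autX x] by (simp only: defs(1)[symmetric] word)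
    also have "\<dots> = - l + (F + (l + l)) + - l + - F + l" by (simp only: word)
    also have "\<dots> = L h + l" by (simp only: Fl Lh word)
    finally have *: "L (app (- l + F + l) x) = L h + l" .
    have X: "app (- l + F + l) x \<in> carrier Q" using x by simp
    have "app (- l + F + l) x = app (L (app (- l + F + l) x)) \<one>" using X by (simp only: L_app one_closed r_one)
    also have "\<dots> = h \<otimes> x" using x unfolding * by (simp add: defs(1))
    finally show ?thesis using * by (simp only: defs(1))
  qed
  have Rhl: "l + R h = R h + l"
  proof -
    have "R x + R h = R \<one> + R (h \<otimes> x)" using cyc_LR[of h x "h \<otimes> x" \<one>] hx x by simp
    also have "\<dots> = r + - l + R h + l" using x by (simp add: law_R defs(1,2))
    finally have "r + R h = r + (- l + R h + l)" by (simp only: defs(2) word)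
    then have "R h = - l + R h + l" by (rule add_left_imp_eq)
    then have "l + R h = l + (- l + R h + l)" by simp
    then show ?thesis by (simp only: word)
  qed
  have Rh: "R h = - (F + - e)"
  proof -
    have w: "R h = r + - l + (- e + - r) + l"
      using x by (simp only: defs(5) eta_def law_R ldiv_props one_closed L_rinv R_rinv defs(1-3) word)
    have "R h = (l + R h) + - l" unfolding Rhl by (simp only: word)
    also have "\<dots> = l + (r + - l + (- e + - r) + l) + - l" by (simp only: w)
    also have "\<dots> = e + - F" by (simp only: F_def e word)
    finally show ?thesis by (simp only: word)
  qed
  \<comment> \<open>With \<open>B(x)\<close> the basic autotopism of \<open>x\<close>, this is \<open>B(x)\<^sup>-\<^sup>1 B(t) B(x)\<^sup>-\<^sup>1\<close> times the inverse of the automorphism \<open>E x\<close>.\<close>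
  have R: "autotopism (- R h) (r + - R t + r + - e) (- (l + - r) + (L t + - R t) + - (l + - r) + - e)"
  proof -
    have "autotopism (- l + L t + - l + - e) (- (- r) + - R t + - (- r) + - e)
        (- (l + - r) + (L t + - R t) + - (l + - r) + - e)"
      unfolding defs(1,2) using x automorphism_E[OF x] unfolding automorphism_def defs(3)
      by (intro autotopism_add autotopism_uminus autotopism_B) auto
    moreover have "- l + L t + - l + - e = - R h" by (simp only: Lt Rh word)
    ultimately show ?thesis by simp
  qed
  have beta1: "app (r + - R t + r + - e) \<one> = h"
  proof -
    have "L (rinv x) + l = - l + (e + (l + l)) + - l" using x by (simp only: L_rinv defs word)
    also have "\<dots> = l + e + - l" by (simp only: sq word)
    finally have "app (L (rinv x) + l) x = app l (app e (app (- l) (app l \<one>)))"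
      using lr1 by simp
    then have "rinv x \<otimes> t = x" using x xe lr1 by (simp add: defs(1,4))
    then have "app (- R t) x = rinv x" using x rdiv_mult[of t "rinv x"] by simp
    moreover have "app (- e) \<one> = \<one>" using xe by (metis app_uminus_app(1))
    ultimately show ?thesis using x lr1 by (simp add: defs(2,5) eta_def)
  qed
  define g k where "g = - (l + - r) + (L t + - R t) + - (l + - r) + - e" and "k = r + - R t + r + - e"
  have at: "app (- R h) a \<otimes> app k b = app g (a \<otimes> b)" if "a \<in> carrier Q" "b \<in> carrier Q" for a b
    using R that unfolding autotopism_def g_def[symmetric] k_def[symmetric] by blast
  have kC: "app k b \<in> carrier Q" if "b \<in> carrier Q" for b using R that unfolding autotopism_def k_def[symmetric] by simp
  \<comment> \<open>The autotopism at \<open>(a, \<one>)\<close> gives \<open>(a / h) h = g a\<close>, because \<open>k \<one> = h\<close>.\<close>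
  have gid: "app g a = a" if "a \<in> carrier Q" for a
    using at[of a \<one>] that beta1 by (simp add: k_def)
  have kh: "app k b = h \<otimes> b" if "b \<in> carrier Q" for b
    using at[of h b] that gid kC by simp
  have "(a \<otimes> h) \<otimes> b = a \<otimes> (h \<otimes> b)" if "a \<in> carrier Q" "b \<in> carrier Q" for a b
    using at[of "a \<otimes> h" b] that gid kh by simp
  then show ?thesis using C(2) unfolding N_def defs(5) by blast
qed

lemma N_one [simp]: "\<one> \<in> N" by (rule N_leftI) auto

section \<open>The nucleus as a normal subloop\<close>

text \<open>
  The nucleus is the set of values at \<open>\<one>\<close> of the first components of autotopisms with trivial second component.
  In this form closure under products, inverses and conjugation is immediate, as such autotopisms form a group
  that is normal in the group of all autotopisms.
\<close>

lemma autotopism_left_N: assumes "autotopism f 0 h"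
  shows "app f \<one> \<in> N" "a \<in> carrier Q \<Longrightarrow> app f a = app f \<one> \<otimes> a"
proof -
  have fS: "f \<in> Sym" "h \<in> Sym" and m: "app f a \<otimes> b = app h (a \<otimes> b)"
    if "a \<in> carrier Q" "b \<in> carrier Q" for a b
    using assms that unfolding autotopism_def by auto
  have Sym: "f \<in> Sym" using assms unfolding autotopism_def by blast
  have h: "app h b = app f \<one> \<otimes> b" if "b \<in> carrier Q" for b using m[of \<one> b] that by simp
  have f: "app f a = app f \<one> \<otimes> a" if "a \<in> carrier Q" for a using m[of a \<one>] h[of a] that Sym by simp
  show "a \<in> carrier Q \<Longrightarrow> app f a = app f \<one> \<otimes> a" by (rule f)
  show "app f \<one> \<in> N"
  proof (rule N_leftI)
    fix x y assume xy: "x \<in> carrier Q" "y \<in> carrier Q"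
    show "app f \<one> \<otimes> x \<otimes> y = app f \<one> \<otimes> (x \<otimes> y)"
      using m[OF xy] h[of "x \<otimes> y"] f[OF xy(1)] xy by simp
  qed (use Sym in simp)
qed

lemma N_autotopism: "n \<in> N \<Longrightarrow> autotopism (L n) 0 (L n)"
  unfolding autotopism_def by (simp add: N_left)

lemma N_mult [simp]: assumes "m \<in> N" "n \<in> N" shows "m \<otimes> n \<in> N"
proof -
  have "autotopism (L m + L n) 0 (L m + L n)" using autotopism_add[OF N_autotopism[OF assms(1)] N_autotopism[OF assms(2)]] by simp
  from autotopism_left_N(1)[OF this] show ?thesis using assms by simp
qed

lemma N_rinv [simp]: assumes "n \<in> N" shows "rinv n \<in> N"
proof -
  have "autotopism (- L n) 0 (- L n)" using autotopism_uminus[OF N_autotopism[OF assms]] by simp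
  from autotopism_left_N(1)[OF this] show ?thesis using assms by simp
qed

lemma N_rinv_left [simp]: assumes "n \<in> N" shows "rinv n \<otimes> n = \<one>"
proof (rule l_cancel[of n])
  show "n \<otimes> (rinv n \<otimes> n) = n \<otimes> \<one>" using N_left[of n "rinv n" n] assms by simp
qed (use assms in auto)

lemma N_rinv_cancel: "\<lbrakk>n \<in> N; u \<in> carrier Q\<rbrakk> \<Longrightarrow> rinv n \<otimes> (n \<otimes> u) = u"
  using N_left[of "rinv n" n u] by simp

lemma N_conj: assumes n: "n \<in> N" and x: "x \<in> carrier Q" shows "conj_by Q n x \<in> N"
proof -
  have "autotopism (- L x + L n + L x) (- (- R x) + 0 + - R x) (- (L x + - R x) + L n + (L x + - R x))"
    by (intro autotopism_add autotopism_uminus autotopism_B N_autotopism n x)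
  then have "app (- L x + L n + L x) \<one> \<in> N" by (intro autotopism_left_N(1)) simp
  then show ?thesis using n x by (simp add: conj_by_def)
qed

lemma conj_eq: assumes n: "n \<in> N" and x: "x \<in> carrier Q" shows "x \<otimes> conj_by Q n x = n \<otimes> x"
  using assms by (simp add: conj_by_def)

lemma N_swap: assumes n: "n \<in> N" and x: "x \<in> carrier Q"
  obtains m where "m \<in> N" "x \<otimes> n = m \<otimes> x"
proof -
  let ?f = "L x + L n + - L x"
  have at: "autotopism ?f (- R x + 0 + - (- R x)) (L x + - R x + L n + - (L x + - R x))"
    by (intro autotopism_add autotopism_uminus autotopism_B N_autotopism n x)
  then have at: "autotopism ?f 0 (L x + - R x + L n + - (L x + - R x))" by simp
  have "app ?f x = app ?f \<one> \<otimes> x" by (rule autotopism_left_N(2)[OF at x])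
  moreover have "app ?f x = x \<otimes> n" using n x by simp
  ultimately show ?thesis using that autotopism_left_N(1)[OF at] by metis
qed

lemma eta_linv: assumes "y \<in> carrier Q" shows "eta y \<otimes> linv y = rinv y"
proof (rule r_cancel[of _ y])
  have "eta y \<otimes> linv y \<otimes> y = eta y \<otimes> (linv y \<otimes> y)" using assms eta_nuclear[of y] by (intro N_left) auto
  then show "eta y \<otimes> linv y \<otimes> y = rinv y \<otimes> y" using assms eta_nuclear[of y] by (simp add: eta_def)
qed (use assms eta_nuclear[of y] in auto)

section \<open>Inner mappings are automorphisms\<close>

text \<open>
  The Buchsteiner law for the triple \<open>x, y\<close> and the right inverse of \<open>xy\<close>, rewritten with the help of \<open>\<eta>(x)\<close>.
\<close>

lemma weak_inverse: assumes x: "x \<in> carrier Q" and y: "y \<in> carrier Q"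
  shows "rinv (x \<otimes> y) \<otimes> x = rinv y \<otimes> eta x"
proof (rule l_cancel[of y])
  have eN: "eta x \<in> N" by (rule eta_nuclear[OF x])
  let ?z = "rinv (x \<otimes> y)"
  have "rdiv Q (y \<otimes> (?z \<otimes> x)) x = rinv x"
    using buchsteiner[of x y ?z] x y by simp
  then have "y \<otimes> (?z \<otimes> x) = rinv x \<otimes> x"
    using rdiv_props(2)[of x "y \<otimes> (?z \<otimes> x)"] x y by simp
  also have "\<dots> = y \<otimes> (rinv y \<otimes> eta x)" using N_right[OF eN, of y "rinv y"] y eN by (simp add: eta_def)
  finally show "y \<otimes> (?z \<otimes> x) = y \<otimes> (rinv y \<otimes> eta x)" .
qed (use x y eta_nuclear[OF x] in auto)

text \<open>
  This element is the companion of the left inner mapping of \<open>x, y\<close>. Modulo the nucleus left and right inverses agree, so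
  \<open>weak_inverse\<close> says that \<open>(xy)\<^sup>-\<^sup>1 x\<close> and \<open>y\<^sup>-\<^sup>1\<close> agree up to a nuclear factor.
\<close>

lemma companion_nuclear: assumes x: "x \<in> carrier Q" and y: "y \<in> carrier Q"
  shows "rdiv Q (linv y) x \<otimes> (x \<otimes> y) \<in> N"
proof -
  let ?w = "x \<otimes> y"
  have N: "eta x \<in> N" "eta y \<in> N" "eta ?w \<in> N" using x y by (auto intro: eta_nuclear)
  have w: "?w \<in> carrier Q" using x y by simp
  obtain m where m: "m \<in> N" "linv y \<otimes> eta x = m \<otimes> linv y" using N_swap[OF N(1), of "linv y"] y by auto
  \<comment> \<open>Chosen such that \<open>n\<close> times the left inverse of \<open>y\<close> is the left inverse of \<open>xy\<close> times \<open>x\<close>.\<close>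
  define n where "n = rinv (eta ?w) \<otimes> (eta y \<otimes> m)"
  have nN: "n \<in> N" using N m by (simp add: n_def)
  have "eta ?w \<otimes> (linv ?w \<otimes> x) = rinv ?w \<otimes> x"
    using N_left[OF N(3), of "linv ?w" x] eta_linv[OF w] x y by simp
  also have "\<dots> = eta y \<otimes> (m \<otimes> linv y)"
    using weak_inverse[OF x y] eta_linv[OF y] N_left[OF N(2), of "linv y" "eta x"] m N y by simp
  finally have "rinv (eta ?w) \<otimes> (eta ?w \<otimes> (linv ?w \<otimes> x)) = rinv (eta ?w) \<otimes> (eta y \<otimes> (m \<otimes> linv y))" by simp
  then have "linv ?w \<otimes> x = n \<otimes> linv y"
    using N m x y by (simp add: n_def N_left N_rinv_cancel)
  then have "rinv n \<otimes> (linv ?w \<otimes> x) = linv y"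
    using nN y by (simp add: N_rinv_cancel)
  then have "(rinv n \<otimes> linv ?w) \<otimes> x = linv y" using nN x y by (simp add: N_left)
  then have "rdiv Q (linv y) x = rinv n \<otimes> linv ?w" using rdiv_mult[of x "rinv n \<otimes> linv ?w"] x y nN by simp
  then have "rdiv Q (linv y) x \<otimes> ?w = rinv n" using nN x y by (simp add: N_left)
  then show ?thesis using nN by simp
qed

definition inner :: "'a \<Rightarrow> 'a \<Rightarrow> 'a symm" where "inner x y = - L (x \<otimes> y) + (L x + L y)"

lemma L_inner: "L (x \<otimes> y) + inner x y = L x + L y" by (simp only: inner_def word)

text \<open>
  The same permutation \<open>inner x y\<close> also occurs in the product rule for right translations, as a comparison of the words for
  \<open>L\<^bsub>xy\<^esub>\<close> and \<open>R\<^bsub>xy\<^esub>\<close> shows.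
\<close>

lemma R_inner: assumes "x \<in> carrier Q" "y \<in> carrier Q" shows "R (x \<otimes> y) = R y + R x + inner x y"
  using assms by (simp only: inner_def law_L law_R word)

lemma inner_app: assumes "x \<in> carrier Q" "y \<in> carrier Q" "z \<in> carrier Q"
  shows "(x \<otimes> y) \<otimes> app (inner x y) z = x \<otimes> (y \<otimes> z)"
  using assms by (simp add: inner_def)

text \<open>
  The inner mapping is the first component of a product of basic autotopisms. It fixes \<open>\<one>\<close>, and its companion is
  nuclear, so that it can be divided out.
\<close>

lemma automorphism_inner: assumes x: "x \<in> carrier Q" and y: "y \<in> carrier Q" shows "automorphism (inner x y)"
proof -
  let ?w = "x \<otimes> y"
  let ?f = "inner x y" and ?g = "- (- R ?w) + (- R x + - R y)"
  define h where "h = - (L ?w + - R ?w) + ((L x + - R x) + (L y + - R y))"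
  have at: "autotopism ?f ?g h" unfolding inner_def h_def by (intro autotopism_add autotopism_uminus autotopism_B m_closed x y)
  have 1: "app ?f \<one> = \<one>" using x y by (simp add: inner_def)
  define c where "c = app ?g \<one>"
  have c: "c \<in> N" using companion_nuclear[OF x y] x y by (simp add: c_def)
  have Sym: "?f \<in> Sym" "?g \<in> Sym" using at unfolding autotopism_def by auto
  have g: "?g = R c + ?f"
  proof (rule Sym_eqI)
    fix b assume b: "b \<in> carrier Q"
    show "app ?g b = app (R c + ?f) b" using autotopism_fix_one(2)[OF at 1 b] b Sym c by (simp add: c_def)
  qed (use Sym c in auto)
  have "autotopism 0 (R c) (R c)" using c unfolding autotopism_def by (simp add: N_right)
  \<comment> \<open>Dividing by this autotopism removes the companion \<open>c\<close> from the second and third component.\<close>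
  from autotopism_add[OF autotopism_uminus[OF this] at[unfolded autotopism_fix_one(1)[OF at 1] g]]
  show ?thesis unfolding automorphism_def by (simp only: word)
qed

section \<open>Associators are nuclear\<close>

text \<open>
  The group generated by the right translations and the automorphisms: by \<open>R_inner\<close>, a product of right translations is
  a single one times an automorphism.
\<close>

definition RAut :: "'a symm set" where "RAut = {R a + A | a A. a \<in> carrier Q \<and> automorphism A}"

lemma RAut_I: "\<lbrakk>a \<in> carrier Q; automorphism A\<rbrakk> \<Longrightarrow> R a + A \<in> RAut" unfolding RAut_def by blast

lemma RAut_R: "a \<in> carrier Q \<Longrightarrow> R a \<in> RAut" using RAut_I[of a 0] automorphism_zero by simp

lemma RAut_automorphism: "automorphism A \<Longrightarrow> A \<in> RAut" using RAut_I[of \<one> A] by simp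

lemma RAut_add: assumes "g \<in> RAut" "h \<in> RAut" shows "g + h \<in> RAut"
proof -
  obtain a A b B where g: "g = R a + A" "a \<in> carrier Q" "automorphism A" and h: "h = R b + B" "b \<in> carrier Q" "automorphism B"
    using assms unfolding RAut_def by blast
  let ?b = "app A b"
  have b: "?b \<in> carrier Q" using automorphism_Sym[OF g(3)] h by simp
  have "g + h = R a + (A + R b) + B" by (simp only: g h word)
  also have "\<dots> = R a + R ?b + (A + B)" by (simp only: automorphism_R[OF g(3) h(2)] word)
  also have "\<dots> = R (?b \<otimes> a) + (- inner ?b a + (A + B))" using b g(2) by (simp only: R_inner word)
  finally show ?thesis using g h b by (auto intro!: RAut_I automorphism_add automorphism_uminus automorphism_inner)
qed

lemma RAut_uminus: assumes "g \<in> RAut" shows "- g \<in> RAut"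
proof -
  obtain a A where g: "g = R a + A" "a \<in> carrier Q" "automorphism A" using assms unfolding RAut_def by blast
  \<comment> \<open>The inverse of a right translation is a right translation only up to an automorphism.\<close>
  have "- R a = E a + R (rinv a)" using g(2) by (simp only: R_rinv word)
  then have "- g = - A + E a + R (rinv a)" by (simp only: g word)
  moreover have "- A + E a + R (rinv a) \<in> RAut"
    by (intro RAut_add RAut_automorphism RAut_R automorphism_uminus automorphism_E g(2,3)) (use g in simp)
  ultimately show ?thesis by simp
qed

text \<open>
  The assumption means \<open>q a = T(a) q\<close>. In the basic autotopism of \<open>q\<close>, this allows every \<open>L\<^sub>q\<close> to be replaced by \<open>R\<^sub>q T\<close>,
  and the resulting identity expresses that \<open>q\<close> associates in the middle.
\<close>

lemma nuclear_if_conj_automorphism: assumes q: "q \<in> carrier Q" and T: "automorphism T" and e: "L q = R q + T"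
  shows "q \<in> N"
proof -
  have TS: "T \<in> Sym" by (rule automorphism_Sym[OF T])
  have "app (L q) q = app (R q + T) q" by (simp only: e)
  then have Tq: "app T q = q" using q TS by (metis L_app R_app Sym_closed app_add r_cancel)
  have Td: "app T (rdiv Q u q) \<otimes> q = app T u" if "u \<in> carrier Q" for u
    using automorphism_mult[OF T, of "rdiv Q u q" q] that q Tq by simp
  have k: "(app T a \<otimes> q) \<otimes> rdiv Q b q = app T a \<otimes> app T b"
    if ab: "a \<in> carrier Q" "b \<in> carrier Q" for a b
  proof -
    have "app (L q) a \<otimes> app (- R q) b = app (L q + - R q) (a \<otimes> b)"
      using autotopism_B[OF q] ab unfolding autotopism_def by blast
    then have "(app T a \<otimes> q) \<otimes> rdiv Q b q = app T (rdiv Q (a \<otimes> b) q) \<otimes> q"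
      using ab q TS unfolding e by simp
    also have "\<dots> = app T a \<otimes> app T b" using Td[of "a \<otimes> b"] ab by (simp add: automorphism_mult[OF T])
    finally show ?thesis .
  qed
  \<comment> \<open>Taking \<open>a = \<one>\<close> expresses \<open>T\<close> by \<open>q\<close> alone.\<close>
  have Tb: "app T b = q \<otimes> rdiv Q b q" if "b \<in> carrier Q" for b
    using k[of \<one> b] that q TS automorphism_one[OF T] by simp
  have "(a \<otimes> q) \<otimes> b = a \<otimes> (q \<otimes> b)" if "a \<in> carrier Q" "b \<in> carrier Q" for a b
    using k[of "app (- T) a" "b \<otimes> q"] Tb[of "b \<otimes> q"] that q TS by simp
  then show ?thesis using q unfolding N_def by blast
qed

lemma associator_props: assumes "x \<in> carrier Q" "y \<in> carrier Q" "z \<in> carrier Q"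
  shows "associator Q x y z \<in> carrier Q"
    "(x \<otimes> (y \<otimes> z)) \<otimes> associator Q x y z = (x \<otimes> y) \<otimes> z"
  using assms by (simp_all add: associator_def)

lemma associator_eqI: assumes "(x \<otimes> (y \<otimes> z)) \<otimes> a = (x \<otimes> y) \<otimes> z"
   "x \<in> carrier Q" "y \<in> carrier Q" "z \<in> carrier Q" "a \<in> carrier Q"
  shows "associator Q x y z = a"
  using assms by (metis associator_def ldiv_mult m_closed)

text \<open>
  Let \<open>p\<close> be the inner mapping of \<open>x, y\<close> and \<open>v = p(z)\<close>, so that the associator is \<open>q\<close> with \<open>v q = z\<close>. Consider
  \<open>g = L\<^sub>v\<^sup>-\<^sup>1 L\<^sub>z\<close>. On the one hand it equals \<open>L\<^sub>q\<close> times the inverse of an inner mapping. On the other hand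
  \<open>L\<^sub>v = p L\<^sub>z p\<^sup>-\<^sup>1\<close>, and \<open>p\<close> is a word in right translations, whose conjugates by \<open>L\<^sub>z\<close> are again words in right translations;
  so \<open>g\<close> is also a right translation times an automorphism. The two descriptions agree at \<open>\<one>\<close>, hence \<open>L\<^sub>q\<close> and \<open>R\<^sub>q\<close> differ by an automorphism.
\<close>

lemma associator_nuclear: assumes x: "x \<in> carrier Q" and y: "y \<in> carrier Q" and z: "z \<in> carrier Q"
  shows "associator Q x y z \<in> N"
proof -
  define w p v q where "w = x \<otimes> y" and "p = inner x y" and "v = app (inner x y) z"
    and "q = ldiv Q (app (inner x y) z) z"
  note defs = this
  have pa: "automorphism p" using automorphism_inner[OF x y] by (simp only: defs)
  have C [simp]: "w \<in> carrier Q" "v \<in> carrier Q" using x y z automorphism_Sym[OF pa] by (auto simp: defs(1,3) defs(2)[symmetric])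
  have qC [simp]: "q \<in> carrier Q" and vq: "v \<otimes> q = z" using z C(2) by (auto simp: defs(4) defs(3)[symmetric])
  define g where "g = - L v + L z"
  have Lv: "L v = p + L z + - p"
    using automorphism_L[OF pa z] by (simp only: defs word)
  have gL: "g = L q + - inner v q"
    using L_inner[of v q] by (simp only: vq g_def inner_def word)
  \<comment> \<open>The law expresses conjugation by \<open>L\<^sub>z\<close> through right translations.\<close>
  have cj: "- L z + R a + L z = - R z + R (a \<otimes> z)" if "a \<in> carrier Q" for a
    using law_R[OF z that] by (simp only: word)
  have p: "- p = - R w + R y + R x" using R_inner[OF x y] by (simp only: defs word)
  have "g = p + (- L z + - p + L z)" by (simp only: g_def Lv word)
  also have "- L z + - p + L z = - (- L z + R w + L z) + (- L z + R y + L z) + (- L z + R x + L z)"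
    by (simp only: p word)
  also have "\<dots> = - (- R z + R (w \<otimes> z)) + (- R z + R (y \<otimes> z)) + (- R z + R (x \<otimes> z))"
    using x y by (simp only: cj C)
  also have "p + \<dots> \<in> RAut"
    using pa x y z by (intro RAut_add RAut_uminus RAut_automorphism RAut_R) auto
  finally have "g \<in> RAut" .
  then obtain a B where g: "g = R a + B" "a \<in> carrier Q" "automorphism B" unfolding RAut_def by blast
  have "app g \<one> = a" using g(2,3) automorphism_one[OF g(3)] by (simp add: g(1))
  moreover have "app g \<one> = q" using automorphism_one[OF automorphism_uminus[OF automorphism_inner[OF C(2) qC]]] by (simp add: gL)
  ultimately have "a = q" by simp
  then have "L q = R q + (B + inner v q)" using gL g(1) by (simp only: word) (metis word(1) diff_conv_add_uminus diff_eq_eq)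
  then have qN: "q \<in> N" using g(3) by (intro nuclear_if_conj_automorphism[OF qC, of "B + inner v q"] automorphism_add automorphism_inner) auto
  have "(x \<otimes> (y \<otimes> z)) \<otimes> q = (w \<otimes> v) \<otimes> q" using inner_app[OF x y z] by (simp only: defs)
  also have "\<dots> = w \<otimes> z" using N_right[OF qN, of w v] vq by simp
  finally have "associator Q x y z = q" using x y z by (intro associator_eqI) (auto simp: defs(1))
  then show ?thesis using qN by simp
qed

section \<open>The action on the center of the nucleus\<close>

definition ZN :: "'a set" where "ZN = {a \<in> N. \<forall>n\<in>N. a \<otimes> n = n \<otimes> a}"

lemma ZN_N: "a \<in> ZN \<Longrightarrow> a \<in> N" unfolding ZN_def by blast
lemma ZN_comm: "\<lbrakk>a \<in> ZN; n \<in> N\<rbrakk> \<Longrightarrow> a \<otimes> n = n \<otimes> a" unfolding ZN_def by blast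
lemma ZN_I: "\<lbrakk>a \<in> N; \<And>n. n \<in> N \<Longrightarrow> a \<otimes> n = n \<otimes> a\<rbrakk> \<Longrightarrow> a \<in> ZN" unfolding ZN_def by blast
declare ZN_N [simp]

abbreviation act (infixl "\<triangleleft>" 80) where "n \<triangleleft> x \<equiv> conj_by Q n x"

lemma act_eqI: "\<lbrakk>n \<in> N; x \<in> carrier Q; m \<in> carrier Q; x \<otimes> m = n \<otimes> x\<rbrakk> \<Longrightarrow> n \<triangleleft> x = m"
  using conj_eq[of n x] N_conj[of n x] by (metis N_carrier l_cancel)

lemma act_mult: assumes "m \<in> N" "n \<in> N" "x \<in> carrier Q"
  shows "(m \<otimes> n) \<triangleleft> x = m \<triangleleft> x \<otimes> n \<triangleleft> x"
proof (rule act_eqI)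
  have "x \<otimes> (m \<triangleleft> x \<otimes> n \<triangleleft> x) = (x \<otimes> m \<triangleleft> x) \<otimes> n \<triangleleft> x"
    using assms N_conj by (simp add: N_right)
  also have "\<dots> = m \<otimes> (x \<otimes> n \<triangleleft> x)" using assms N_conj by (simp add: conj_eq N_left)
  also have "\<dots> = (m \<otimes> n) \<otimes> x" using assms by (simp add: conj_eq N_left)
  finally show "x \<otimes> (m \<triangleleft> x \<otimes> n \<triangleleft> x) = m \<otimes> n \<otimes> x" .
qed (use assms N_conj in auto)

lemma act_act: assumes "n \<in> N" "x \<in> carrier Q" "y \<in> carrier Q"
  shows "n \<triangleleft> (x \<otimes> y) = n \<triangleleft> x \<triangleleft> y"
proof (rule act_eqI)
  have N: "n \<triangleleft> x \<in> N" "n \<triangleleft> x \<triangleleft> y \<in> N" using assms N_conj by auto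
  have "(x \<otimes> y) \<otimes> n \<triangleleft> x \<triangleleft> y = x \<otimes> (y \<otimes> n \<triangleleft> x \<triangleleft> y)" using assms N by (simp add: N_right)
  also have "\<dots> = (x \<otimes> n \<triangleleft> x) \<otimes> y" using assms N by (simp add: conj_eq[OF N(1)] N_mid)
  also have "\<dots> = n \<otimes> (x \<otimes> y)" using assms by (simp add: conj_eq N_left)
  finally show "(x \<otimes> y) \<otimes> n \<triangleleft> x \<triangleleft> y = n \<otimes> (x \<otimes> y)" .
qed (use assms N_conj in auto)

lemma act_one [simp]: "n \<in> N \<Longrightarrow> n \<triangleleft> \<one> = n" by (rule act_eqI) auto
lemma one_act [simp]: "x \<in> carrier Q \<Longrightarrow> \<one> \<triangleleft> x = \<one>" by (rule act_eqI) auto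

lemma act_inj: assumes "m \<triangleleft> x = n \<triangleleft> x" "m \<in> N" "n \<in> N" "x \<in> carrier Q" shows "m = n"
  using conj_eq[of m x] conj_eq[of n x] assms by (metis N_carrier r_cancel)

lemma act_N: "\<lbrakk>a \<in> ZN; n \<in> N\<rbrakk> \<Longrightarrow> a \<triangleleft> n = a" using ZN_comm[of a n] by (intro act_eqI) auto

lemma ZN_one [simp]: "\<one> \<in> ZN" by (rule ZN_I) auto

lemma ZN_mult [simp]: assumes "a \<in> ZN" "b \<in> ZN" shows "a \<otimes> b \<in> ZN"
proof (rule ZN_I)
  fix n assume n: "n \<in> N"
  have "a \<otimes> b \<otimes> n = a \<otimes> (n \<otimes> b)" using assms n by (simp add: N_left ZN_comm[of b n])
  also have "\<dots> = n \<otimes> a \<otimes> b" using assms n by (simp add: N_left[symmetric] ZN_comm[of a n])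
  finally show "a \<otimes> b \<otimes> n = n \<otimes> (a \<otimes> b)" using assms n by (simp add: N_left)
qed (use assms in auto)

lemma ZN_rinv [simp]: assumes "a \<in> ZN" shows "rinv a \<in> ZN"
proof (rule ZN_I)
  fix n assume n: "n \<in> N"
  show "rinv a \<otimes> n = n \<otimes> rinv a"
  proof (rule l_cancel[of a])
    have "a \<otimes> (n \<otimes> rinv a) = n \<otimes> a \<otimes> rinv a"
      using assms n by (simp add: N_left[symmetric] ZN_comm[of a n])
    also have "\<dots> = n" using assms n by (simp add: N_left)
    finally show "a \<otimes> (rinv a \<otimes> n) = a \<otimes> (n \<otimes> rinv a)"
      using assms n N_left[of a "rinv a" n] by simp
  qed (use assms n in auto)
qed (use assms in auto)

lemma ZN_act [simp]: assumes a: "a \<in> ZN" and x: "x \<in> carrier Q" shows "a \<triangleleft> x \<in> ZN"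
proof (rule ZN_I)
  show N: "a \<triangleleft> x \<in> N" using assms N_conj by auto
  fix n assume n: "n \<in> N"
  obtain m where m: "m \<in> N" "x \<otimes> n = m \<otimes> x" using N_swap[OF n x] .
  have "x \<otimes> (a \<triangleleft> x \<otimes> n) = a \<otimes> (x \<otimes> n)"
    using assms n N N_right[OF n x, of "a \<triangleleft> x"] by (simp add: conj_eq N_left)
  also have "\<dots> = (a \<otimes> m) \<otimes> x" using assms m by (simp add: N_left)
  also have "\<dots> = m \<otimes> (a \<otimes> x)" using assms m by (simp add: ZN_comm[OF a m(1)] N_left)
  also have "\<dots> = (m \<otimes> x) \<otimes> a \<triangleleft> x" using assms m N by (simp add: conj_eq N_left)
  also have "\<dots> = (x \<otimes> n) \<otimes> a \<triangleleft> x" using m by simp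
  also have "\<dots> = x \<otimes> (n \<otimes> a \<triangleleft> x)" using assms n N by (simp add: N_right)
  finally have "x \<otimes> (a \<triangleleft> x \<otimes> n) = x \<otimes> (n \<otimes> a \<triangleleft> x)" .
  then show "a \<triangleleft> x \<otimes> n = n \<otimes> a \<triangleleft> x" by (rule l_cancel) (use N n x in auto)
qed

abbreviation Z where "Z \<equiv> Q\<lparr>carrier := ZN\<rparr>"

lemma Z_comm_group: "comm_group Z"
proof (rule comm_groupI)
  fix a assume "a \<in> carrier Z"
  then show "\<exists>b\<in>carrier Z. b \<otimes>\<^bsub>Z\<^esub> a = \<one>\<^bsub>Z\<^esub>" by (intro bexI[of _ "rinv a"]) auto
next
  fix a b assume "a \<in> carrier Z" "b \<in> carrier Z"
  then show "a \<otimes>\<^bsub>Z\<^esub> b = b \<otimes>\<^bsub>Z\<^esub> a" using ZN_comm[of a b] by simp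
qed (auto simp: N_left)

interpretation Z: comm_group Z
  rewrites "carrier Z = ZN" and "mult Z = mult Q" and "one Z = one Q"
  by (rule Z_comm_group) auto

section \<open>Basic identities for associators\<close>

abbreviation asc where "asc \<equiv> associator Q"

lemma asc_eq: "\<lbrakk>x \<in> carrier Q; y \<in> carrier Q; z \<in> carrier Q\<rbrakk> \<Longrightarrow> (x \<otimes> y) \<otimes> z = (x \<otimes> (y \<otimes> z)) \<otimes> asc x y z"
  by (simp add: associator_props)

text \<open>
  Multiplying \<open>z\<close> by \<open>n\<close> on the right conjugates \<open>[x,y,z]\<close> by \<open>n\<close>. But \<open>n\<close> can be moved through \<open>z\<close>, \<open>y\<close> and \<open>x\<close> to the front,
  where a nuclear factor does not influence the associator.
\<close>

lemma associator_central: assumes x: "x \<in> carrier Q" and y: "y \<in> carrier Q" and z: "z \<in> carrier Q"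
  shows "asc x y z \<in> ZN"
proof (rule ZN_I)
  show fN: "asc x y z \<in> N" using assms by (rule associator_nuclear)
  fix n assume n: "n \<in> N"
  let ?u = "x \<otimes> (y \<otimes> z)"
  have zn: "z \<otimes> n \<in> carrier Q" using z n by simp
  obtain m1 where m1: "m1 \<in> N" "z \<otimes> n = m1 \<otimes> z" using N_swap[OF n z] .
  obtain m2 where m2: "m2 \<in> N" "y \<otimes> m1 = m2 \<otimes> y" using N_swap[OF m1(1) y] .
  obtain m3 where m3: "m3 \<in> N" "x \<otimes> m2 = m3 \<otimes> x" using N_swap[OF m2(1) x] .
  have l: "(x \<otimes> y) \<otimes> (z \<otimes> n) = m3 \<otimes> ((x \<otimes> y) \<otimes> z)"
  proof -
    have "(x \<otimes> y) \<otimes> (z \<otimes> n) = ((x \<otimes> y) \<otimes> m1) \<otimes> z" using x y z m1 by (simp only: N_mid m_closed)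
    also have "\<dots> = (x \<otimes> (m2 \<otimes> y)) \<otimes> z" using x y m1 m2 by (simp add: N_right)
    also have "\<dots> = ((x \<otimes> m2) \<otimes> y) \<otimes> z" using N_mid[OF m2(1) x y] by simp
    also have "\<dots> = ((m3 \<otimes> x) \<otimes> y) \<otimes> z" using m3 by simp
    finally show ?thesis using x y z m3(1) by (simp add: N_left)
  qed
  have r: "x \<otimes> (y \<otimes> (z \<otimes> n)) = m3 \<otimes> ?u"
  proof -
    have "y \<otimes> (z \<otimes> n) = m2 \<otimes> (y \<otimes> z)" using y z m1 m2 N_mid[OF m1(1) y z] N_left[OF m2(1) y z] by simp
    then have "x \<otimes> (y \<otimes> (z \<otimes> n)) = (x \<otimes> m2) \<otimes> (y \<otimes> z)" using x y z N_mid[OF m2(1) x, of "y \<otimes> z"] by simp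
    also have "\<dots> = (m3 \<otimes> x) \<otimes> (y \<otimes> z)" using m3 by simp
    finally show ?thesis using x y z m3(1) by (simp add: N_left)
  qed
  have "(m3 \<otimes> ?u) \<otimes> asc x y z = m3 \<otimes> ((x \<otimes> y) \<otimes> z)"
    using x y z m3 fN by (simp add: N_left associator_props)
  also have "\<dots> = ?u \<otimes> asc x y z \<otimes> n"
    using l[symmetric] x y z n N_right[OF n, of "x \<otimes> y" z] by (simp add: associator_props)
  also have "\<dots> = ?u \<otimes> (asc x y z \<otimes> n)" using x y z n fN by (simp add: N_right)
  finally have "(m3 \<otimes> ?u) \<otimes> asc x y z = ?u \<otimes> (asc x y z \<otimes> n)" .
  moreover have "m3 \<otimes> ?u = ?u \<otimes> n" using r x y z n by (simp add: N_right)
  ultimately have "?u \<otimes> (n \<otimes> asc x y z) = ?u \<otimes> (asc x y z \<otimes> n)" using x y z n fN by (simp add: N_right)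
  then show "asc x y z \<otimes> n = n \<otimes> asc x y z" using x y z n fN by (intro l_cancel[of ?u "asc x y z \<otimes> n"]) auto
qed

declare associator_central [simp]

text \<open>
  The Buchsteiner law itself, with both sides expressed by associators.
\<close>

lemma associator_cyclic:
  assumes x: "x \<in> carrier Q" and y: "y \<in> carrier Q" and z: "z \<in> carrier Q"
  shows "asc y z x \<otimes> asc x y z \<triangleleft> x = \<one>"
proof -
  have N: "asc x y z \<in> N" "asc y z x \<in> N" "asc x y z \<triangleleft> x \<in> N" using assms by simp_all
  have "(x \<otimes> y) \<otimes> z = x \<otimes> ((y \<otimes> z) \<otimes> asc x y z)" using assms N asc_eq[OF x y z] by (simp add: N_right)
  then have "(y \<otimes> z) \<otimes> asc x y z = rdiv Q (y \<otimes> (z \<otimes> x)) x"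
    using buchsteiner[OF assms] x y z N by simp
  then have "y \<otimes> (z \<otimes> x) = ((y \<otimes> z) \<otimes> asc x y z) \<otimes> x" using x y z by simp
  also have "\<dots> = (y \<otimes> z) \<otimes> (x \<otimes> asc x y z \<triangleleft> x)" using x y z N by (simp add: N_mid conj_eq)
  also have "\<dots> = ((y \<otimes> z) \<otimes> x) \<otimes> asc x y z \<triangleleft> x" using x y z N by (simp add: N_right)
  also have "\<dots> = (y \<otimes> (z \<otimes> x)) \<otimes> (asc y z x \<otimes> asc x y z \<triangleleft> x)" using x y z N asc_eq[OF y z x] by (simp add: N_right)
  finally have "(y \<otimes> (z \<otimes> x)) \<otimes> (asc y z x \<otimes> asc x y z \<triangleleft> x) = (y \<otimes> (z \<otimes> x)) \<otimes> \<one>" using x y z by simp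
  then show ?thesis by (rule l_cancel) (use x y z N in auto)
qed

text \<open>
  The inner mapping of \<open>x, y\<close> sends \<open>v\<close> to \<open>v [x,y,v]\<^sup>-\<^sup>1\<close>. That this map is multiplicative is the crossed homomorphism rule.
\<close>

lemma associator_mult_right:
  assumes x: "x \<in> carrier Q" and y: "y \<in> carrier Q" and z: "z \<in> carrier Q" and w: "w \<in> carrier Q"
  shows "asc x y (z \<otimes> w) = asc x y z \<triangleleft> w \<otimes> asc x y w"
proof -
  define l where "l v = app (inner x y) v" for v
  have lC [simp]: "l v \<in> carrier Q" if "v \<in> carrier Q" for v
    using that automorphism_Sym[OF automorphism_inner[OF x y]] by (simp add: l_def)
  have lf: "l v \<otimes> asc x y v = v" if v: "v \<in> carrier Q" for v
  proof -
    have "(x \<otimes> y) \<otimes> (l v \<otimes> asc x y v) = (x \<otimes> (y \<otimes> v)) \<otimes> asc x y v"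
      using x y v inner_app[OF x y v] N_right[of "asc x y v" "x \<otimes> y" "l v"] by (simp add: l_def[symmetric])
    also have "\<dots> = (x \<otimes> y) \<otimes> v" using x y v by (simp add: associator_props)
    finally show ?thesis by (rule l_cancel) (use x y v in auto)
  qed
  have "asc x y z \<triangleleft> w = asc x y z \<triangleleft> (l w \<otimes> asc x y w)" using w by (simp add: lf)
  also have "\<dots> = asc x y z \<triangleleft> l w" using x y z w by (simp add: act_act act_N)
  finally have a: "asc x y z \<triangleleft> w = asc x y z \<triangleleft> l w" .
  have "z \<otimes> w = (l z \<otimes> asc x y z) \<otimes> (l w \<otimes> asc x y w)" using z w by (simp add: lf)
  also have "\<dots> = l z \<otimes> ((asc x y z \<otimes> l w) \<otimes> asc x y w)" using x y z w by (simp add: N_mid N_left)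
  also have "\<dots> = l z \<otimes> (l w \<otimes> (asc x y z \<triangleleft> w \<otimes> asc x y w))"
    using x y z w conj_eq[of "asc x y z" "l w"] N_right[of "asc x y w" "l w" "asc x y z \<triangleleft> l w"] by (simp add: a)
  also have "\<dots> = l (z \<otimes> w) \<otimes> (asc x y z \<triangleleft> w \<otimes> asc x y w)"
    using x y z w automorphism_mult[OF automorphism_inner[OF x y] z w] by (simp add: N_right l_def[symmetric])
  finally have "l (z \<otimes> w) \<otimes> (asc x y z \<triangleleft> w \<otimes> asc x y w) = l (z \<otimes> w) \<otimes> asc x y (z \<otimes> w)"
    using z w lf[of "z \<otimes> w"] by simp
  from l_cancel[OF this] show ?thesis using x y z w by simp
qed

text \<open>
  Two ways of rebracketing \<open>((x y) z) w\<close> to \<open>x (y (z w))\<close>, simplified with the crossed homomorphism rule in the third slot.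
\<close>

lemma associator_cocycle:
  assumes x: "x \<in> carrier Q" and y: "y \<in> carrier Q" and z: "z \<in> carrier Q" and w: "w \<in> carrier Q"
  shows "asc x y w \<otimes> asc (x \<otimes> y) z w = asc y z w \<otimes> asc x (y \<otimes> z) w"
proof -
  let ?b = "x \<otimes> (y \<otimes> (z \<otimes> w))"
  have "((x \<otimes> y) \<otimes> z) \<otimes> w = ?b \<otimes> (asc x y (z \<otimes> w) \<otimes> asc (x \<otimes> y) z w)"
    using assms by (simp add: asc_eq[of "x \<otimes> y" z w] asc_eq[of x y "z \<otimes> w"] N_right)
  moreover have "((x \<otimes> y) \<otimes> z) \<otimes> w = ?b \<otimes> (asc y z w \<otimes> (asc x (y \<otimes> z) w \<otimes> asc x y z \<triangleleft> w))"
  proof -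
    have "((x \<otimes> y) \<otimes> z) \<otimes> w = (x \<otimes> (y \<otimes> z)) \<otimes> (asc x y z \<otimes> w)" using assms by (simp add: asc_eq[of x y z] N_mid)
    also have "\<dots> = ((x \<otimes> (y \<otimes> z)) \<otimes> w) \<otimes> asc x y z \<triangleleft> w" using assms conj_eq[of "asc x y z" w] N_right[of "asc x y z \<triangleleft> w" "x \<otimes> (y \<otimes> z)" w] by simp
    also have "(x \<otimes> (y \<otimes> z)) \<otimes> w = x \<otimes> ((y \<otimes> (z \<otimes> w)) \<otimes> asc y z w) \<otimes> asc x (y \<otimes> z) w"
      using assms by (simp add: asc_eq[of x "y \<otimes> z" w] asc_eq[of y z w])
    finally show ?thesis using assms by (simp add: N_right)
  qed
  ultimately have "?b \<otimes> (asc x y (z \<otimes> w) \<otimes> asc (x \<otimes> y) z w) = ?b \<otimes> (asc y z w \<otimes> (asc x (y \<otimes> z) w \<otimes> asc x y z \<triangleleft> w))" by simp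
  then have "asc x y (z \<otimes> w) \<otimes> asc (x \<otimes> y) z w = asc y z w \<otimes> (asc x (y \<otimes> z) w \<otimes> asc x y z \<triangleleft> w)"
    by (rule l_cancel) (use assms in auto)
  then have "asc x y z \<triangleleft> w \<otimes> (asc x y w \<otimes> asc (x \<otimes> y) z w) = asc x y z \<triangleleft> w \<otimes> (asc y z w \<otimes> asc x (y \<otimes> z) w)"
    using assms by (simp add: associator_mult_right Z.m_ac)
  then show ?thesis by (rule l_cancel) (use assms in auto)
qed

lemma rinv_eqI: "\<lbrakk>a \<otimes> b = \<one>; a \<in> ZN; b \<in> ZN\<rbrakk> \<Longrightarrow> rinv a = b"
  by (metis N_carrier ZN_N ldiv_mult)

lemma rinv_rinv [simp]: "a \<in> ZN \<Longrightarrow> rinv (rinv a) = a" by (rule rinv_eqI) auto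

lemma rinv_mult: "\<lbrakk>a \<in> ZN; b \<in> ZN\<rbrakk> \<Longrightarrow> rinv (a \<otimes> b) = rinv a \<otimes> rinv b"
proof (rule rinv_eqI)
  assume ab: "a \<in> ZN" "b \<in> ZN"
  have "a \<otimes> b \<otimes> (rinv a \<otimes> rinv b) = (a \<otimes> rinv a) \<otimes> (b \<otimes> rinv b)" using ab by (simp only: Z.m_ac ZN_rinv ZN_mult)
  then show "a \<otimes> b \<otimes> (rinv a \<otimes> rinv b) = \<one>" using ab by simp
qed auto

lemma rinv_act: "\<lbrakk>a \<in> ZN; x \<in> carrier Q\<rbrakk> \<Longrightarrow> rinv a \<triangleleft> x = rinv (a \<triangleleft> x)"
proof (rule rinv_eqI[symmetric])
  assume a: "a \<in> ZN" "x \<in> carrier Q"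
  show "a \<triangleleft> x \<otimes> rinv a \<triangleleft> x = \<one>" using a act_mult[of a "rinv a" x] by simp
qed auto

lemma Z_cancel: "\<lbrakk>a \<otimes> b = a \<otimes> c; a \<in> ZN; b \<in> ZN; c \<in> ZN\<rbrakk> \<Longrightarrow> b = c"
  by (rule l_cancel[of a]) auto

lemma Z_move: assumes "a \<otimes> b = c \<otimes> d" "a \<in> ZN" "b \<in> ZN" "c \<in> ZN" "d \<in> ZN"
  shows "a \<otimes> rinv c = d \<otimes> rinv b"
proof (rule Z_cancel[of "b \<otimes> c"])
  have "b \<otimes> c \<otimes> (a \<otimes> rinv c) = (a \<otimes> b) \<otimes> (c \<otimes> rinv c)" using assms(2-) by (simp only: Z.m_ac ZN_rinv ZN_mult)
  also have "\<dots> = (c \<otimes> d) \<otimes> (b \<otimes> rinv b)" using assms by simp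
  also have "\<dots> = b \<otimes> c \<otimes> (d \<otimes> rinv b)" using assms(2-) by (simp only: Z.m_ac ZN_rinv ZN_mult)
  finally show "b \<otimes> c \<otimes> (a \<otimes> rinv c) = b \<otimes> c \<otimes> (d \<otimes> rinv b)" .
qed (use assms in auto)

lemma asc_cyc: assumes "x \<in> carrier Q" "y \<in> carrier Q" "z \<in> carrier Q"
  shows "asc y z x = rinv (asc x y z \<triangleleft> x)"
proof -
  have "asc x y z \<triangleleft> x \<otimes> asc y z x = \<one>"
    using associator_cyclic[OF assms] assms by (simp add: Z.m_comm)
  then show ?thesis using assms by (intro rinv_eqI[symmetric]) auto
qed

lemma asc_cyc2: assumes "x \<in> carrier Q" "y \<in> carrier Q" "z \<in> carrier Q"
  shows "asc z x y = asc x y z \<triangleleft> x \<triangleleft> y"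
  using assms asc_cyc[of y z x] asc_cyc[of x y z] by (simp add: rinv_act)

text \<open>
  Three rotations return to the same associator, with one sign for each and the combined action of \<open>x\<close>, \<open>y\<close>, \<open>z\<close>.
\<close>

lemma asc_cyc3: assumes "x \<in> carrier Q" "y \<in> carrier Q" "z \<in> carrier Q"
  shows "asc x y z \<triangleleft> x \<triangleleft> y \<triangleleft> z = rinv (asc x y z)"
proof -
  have e: "asc x y z = rinv (asc x y z \<triangleleft> x \<triangleleft> y \<triangleleft> z)"
    using asc_cyc[OF assms(3,1,2)] by (simp only: asc_cyc2[OF assms])
  have "rinv (asc x y z) = rinv (rinv (asc x y z \<triangleleft> x \<triangleleft> y \<triangleleft> z))" by (rule arg_cong[OF e])
  then show ?thesis using assms by simp
qed

lemma asc_one [simp]: "\<lbrakk>y \<in> carrier Q; z \<in> carrier Q\<rbrakk> \<Longrightarrow> asc \<one> y z = \<one>"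
  by (simp add: associator_def)

lemma asc_N3: "\<lbrakk>x \<in> carrier Q; y \<in> carrier Q; n \<in> N\<rbrakk> \<Longrightarrow> asc x y n = \<one>"
  by (rule associator_eqI) (auto simp: N_right)

lemma act_linv: assumes "a \<in> ZN" "x \<in> carrier Q"
  shows "a \<triangleleft> linv x \<triangleleft> x = a" "a \<triangleleft> x \<triangleleft> linv x = a"
proof -
  have 1: "b \<triangleleft> linv x \<triangleleft> x = b" if "b \<in> ZN" for b
    using act_act[of b "linv x" x] assms that by simp
  show "a \<triangleleft> linv x \<triangleleft> x = a" using 1 assms by simp
  show "a \<triangleleft> x \<triangleleft> linv x = a"
    by (rule act_inj[of _ x]) (use 1[of "a \<triangleleft> x"] assms in auto)
qed

section \<open>Crossed homomorphisms and commutators\<close>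

text \<open>
  The crossed homomorphism rule of the third slot, carried to the first and second slots by cyclic rotation.
\<close>

lemma asc_mult1: assumes "x \<in> carrier Q" "y \<in> carrier Q" "z \<in> carrier Q" "w \<in> carrier Q"
  shows "asc (x \<otimes> y) z w \<triangleleft> x = asc x z w \<triangleleft> x \<otimes> asc y z w"
proof (rule act_inj[of _ y])
  have "rinv (asc (x \<otimes> y) z w \<triangleleft> x \<triangleleft> y) = asc z w (x \<otimes> y)"
    using asc_cyc[of "x \<otimes> y" z w] assms by (simp add: act_act)
  also have "\<dots> = rinv (asc x z w \<triangleleft> x \<triangleleft> y \<otimes> asc y z w \<triangleleft> y)"
    using associator_mult_right[of z w x y] asc_cyc[of x z w] asc_cyc[of y z w] assms by (simp add: rinv_act rinv_mult)
  finally have "rinv (rinv (asc (x \<otimes> y) z w \<triangleleft> x \<triangleleft> y)) = rinv (rinv (asc x z w \<triangleleft> x \<triangleleft> y \<otimes> asc y z w \<triangleleft> y))" by simp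
  then show "asc (x \<otimes> y) z w \<triangleleft> x \<triangleleft> y = (asc x z w \<triangleleft> x \<otimes> asc y z w) \<triangleleft> y"
    using assms by (simp add: act_mult)
qed (use assms in auto)

lemma asc_mult2: assumes "x \<in> carrier Q" "y \<in> carrier Q" "z \<in> carrier Q" "w \<in> carrier Q"
  shows "asc x (y \<otimes> z) w \<triangleleft> x \<triangleleft> y = asc x y w \<triangleleft> x \<triangleleft> y \<otimes> asc x z w \<triangleleft> x"
proof (rule act_inj[of _ z])
  have "asc x (y \<otimes> z) w \<triangleleft> x \<triangleleft> y \<triangleleft> z = asc w x (y \<otimes> z)"
    using asc_cyc2[of x "y \<otimes> z" w] assms by (simp add: act_act)
  also have "\<dots> = (asc x y w \<triangleleft> x \<triangleleft> y \<otimes> asc x z w \<triangleleft> x) \<triangleleft> z"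
    using associator_mult_right[of w x y z] asc_cyc2[of x y w] asc_cyc2[of x z w] assms by (simp add: act_mult)
  finally show "asc x (y \<otimes> z) w \<triangleleft> x \<triangleleft> y \<triangleleft> z = (asc x y w \<triangleleft> x \<triangleleft> y \<otimes> asc x z w \<triangleleft> x) \<triangleleft> z" .
qed (use assms in auto)

text \<open>
  The cocycle identity after both products in it have been expanded; the two occurrences of
  \<open>[x,y,w]\<close> cancel.
\<close>

lemma asc_star: assumes "x \<in> carrier Q" "y \<in> carrier Q" "z \<in> carrier Q" "w \<in> carrier Q"
  shows "asc x z w \<triangleleft> x \<triangleleft> y \<otimes> asc y z w \<triangleleft> y = asc y z w \<triangleleft> x \<triangleleft> y \<otimes> asc x z w \<triangleleft> x"
proof (rule Z_cancel[of "asc x y w \<triangleleft> x \<triangleleft> y"])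
  have "(asc x y w \<otimes> asc (x \<otimes> y) z w) \<triangleleft> x \<triangleleft> y = (asc y z w \<otimes> asc x (y \<otimes> z) w) \<triangleleft> x \<triangleleft> y"
    using associator_cocycle[OF assms] by simp
  then have "asc x y w \<triangleleft> x \<triangleleft> y \<otimes> (asc x z w \<triangleleft> x \<otimes> asc y z w) \<triangleleft> y
      = asc y z w \<triangleleft> x \<triangleleft> y \<otimes> (asc x y w \<triangleleft> x \<triangleleft> y \<otimes> asc x z w \<triangleleft> x)"
    using assms by (simp add: act_mult asc_mult1 asc_mult2)
  then show "asc x y w \<triangleleft> x \<triangleleft> y \<otimes> (asc x z w \<triangleleft> x \<triangleleft> y \<otimes> asc y z w \<triangleleft> y)
      = asc x y w \<triangleleft> x \<triangleleft> y \<otimes> (asc y z w \<triangleleft> x \<triangleleft> y \<otimes> asc x z w \<triangleleft> x)"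
    using assms by (simp add: act_mult Z.m_lcomm)
qed (use assms in auto)

text \<open>
  Expanded in the first slot, the assertion reads \<open>f(x) + f(y) x\<^sup>-\<^sup>1 = f(y) + f(x) y\<^sup>-\<^sup>1\<close>, where \<open>f(x) = [x,z,w]\<close>.
  This is \<open>asc_star\<close> for the left inverse of \<open>x\<close>.
\<close>

lemma asc_commutes1: assumes x: "x \<in> carrier Q" and y: "y \<in> carrier Q" and z: "z \<in> carrier Q" and w: "w \<in> carrier Q"
  shows "asc (x \<otimes> y) z w = asc (y \<otimes> x) z w"
proof -
  have *: "asc (x \<otimes> y) z w = asc x z w \<otimes> asc y z w \<triangleleft> linv x" if "x \<in> carrier Q" "y \<in> carrier Q" for x y
    using arg_cong[OF asc_mult1[OF that z w], of "\<lambda>a. a \<triangleleft> linv x"] that z w by (simp add: act_mult act_linv)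
  have X: "linv x \<in> carrier Q" using x by simp
  have "asc x z w \<otimes> asc (linv x) z w \<triangleleft> linv x = \<one>"
    using asc_mult1[of "linv x" x z w] x z w by (simp add: Z.m_comm)
  then have gX: "asc (linv x) z w \<triangleleft> linv x = rinv (asc x z w)"
    using x z w by (intro rinv_eqI[symmetric]) auto
  have "rinv (asc x z w) \<triangleleft> y \<otimes> asc y z w \<triangleleft> y = asc y z w \<triangleleft> linv x \<triangleleft> y \<otimes> rinv (asc x z w)"
    using asc_star[OF X y z w] by (simp only: gX)
  then have "rinv (asc x z w \<triangleleft> y) \<otimes> asc y z w \<triangleleft> y = asc y z w \<triangleleft> linv x \<triangleleft> y \<otimes> rinv (asc x z w)"
    using x y z w by (simp only: rinv_act associator_central)
  from Z_move[OF this] have "rinv (asc x z w \<triangleleft> y) \<otimes> rinv (asc y z w \<triangleleft> linv x \<triangleleft> y) = rinv (asc x z w) \<otimes> rinv (asc y z w \<triangleleft> y)"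
    using x y z w by simp
  from arg_cong[OF this, of rinv] have "asc x z w \<otimes> asc y z w \<triangleleft> y = asc x z w \<triangleleft> y \<otimes> asc y z w \<triangleleft> linv x \<triangleleft> y"
    using x y z w by (simp add: rinv_mult)
  then have "asc (x \<otimes> y) z w \<triangleleft> y = asc (y \<otimes> x) z w \<triangleleft> y"
    using x y z w by (simp add: * act_mult act_linv Z.m_comm)
  then show ?thesis by (rule act_inj) (use x y z w in auto)
qed

lemma commutator_nuclear: assumes x: "x \<in> carrier Q" and y: "y \<in> carrier Q"
  shows "ldiv Q (y \<otimes> x) (x \<otimes> y) \<in> N"
proof (rule N_leftI)
  let ?k = "ldiv Q (y \<otimes> x) (x \<otimes> y)"
  show k: "?k \<in> carrier Q" using x y by simp
  fix z w assume zw: "z \<in> carrier Q" "w \<in> carrier Q"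
  have "asc (y \<otimes> x) z w \<triangleleft> (y \<otimes> x) \<otimes> \<one> = asc (x \<otimes> y) z w \<triangleleft> (y \<otimes> x)"
    using asc_commutes1[OF x y zw] x y zw by simp
  also have "\<dots> = asc (y \<otimes> x) z w \<triangleleft> (y \<otimes> x) \<otimes> asc ?k z w"
    using asc_mult1[of "y \<otimes> x" ?k z w] x y zw by simp
  finally have e: "\<one> = asc ?k z w" by (rule l_cancel) (use x y zw in auto)
  show "?k \<otimes> z \<otimes> w = ?k \<otimes> (z \<otimes> w)" using asc_eq[OF k zw] e[symmetric] k zw by simp
qed

lemma act_commute: assumes a: "a \<in> ZN" and x: "x \<in> carrier Q" and y: "y \<in> carrier Q"
  shows "a \<triangleleft> x \<triangleleft> y = a \<triangleleft> y \<triangleleft> x"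
proof -
  let ?k = "ldiv Q (y \<otimes> x) (x \<otimes> y)"
  have "a \<triangleleft> (x \<otimes> y) = a \<triangleleft> ((y \<otimes> x) \<otimes> ?k)" using x y by simp
  also have "\<dots> = a \<triangleleft> (y \<otimes> x) \<triangleleft> ?k" using assms by (intro act_act) auto
  also have "\<dots> = a \<triangleleft> (y \<otimes> x)" using assms commutator_nuclear[OF x y] by (intro act_N) auto
  finally show ?thesis using assms by (simp add: act_act)
qed

section \<open>Squares act trivially\<close>

text \<open>
  Additively, \<open>a - a v\<close>, the image of \<open>a\<close> under \<open>1 - v\<close>.
\<close>

definition D where "D a v = a \<otimes> rinv (a \<triangleleft> v)"

lemma D_Z [simp]: "\<lbrakk>a \<in> ZN; v \<in> carrier Q\<rbrakk> \<Longrightarrow> D a v \<in> ZN" by (simp add: D_def)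

lemma D_act: "\<lbrakk>a \<in> ZN; v \<in> carrier Q; x \<in> carrier Q\<rbrakk> \<Longrightarrow> D a v \<triangleleft> x = D (a \<triangleleft> x) v"
  by (simp add: D_def act_mult rinv_act act_commute[of a x v])

lemma D_rinv: "\<lbrakk>a \<in> ZN; v \<in> carrier Q\<rbrakk> \<Longrightarrow> D (rinv a) v = rinv (D a v)"
  by (simp add: D_def rinv_act rinv_mult)

text \<open>
  Applying \<open>z\<close> and \<open>w\<close> to \<open>asc_star\<close> produces the triple actions \<open>x z w\<close> on \<open>[x,z,w]\<close> and \<open>v z w\<close> on \<open>[v,z,w]\<close>, which are
  inversions by \<open>asc_cyc3\<close>.
\<close>

lemma D_sym1: assumes x: "x \<in> carrier Q" and v: "v \<in> carrier Q" and z: "z \<in> carrier Q" and w: "w \<in> carrier Q"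
  shows "D (asc x z w) v = D (asc v z w) x"
proof -
  let ?p = "asc x z w" and ?s = "asc v z w"
  have p: "?p \<in> ZN" and s: "?s \<in> ZN" using assms by auto
  have p1: "?p \<triangleleft> x \<triangleleft> z \<triangleleft> w = rinv ?p" by (rule asc_cyc3[OF x z w])
  have s1: "?s \<triangleleft> v \<triangleleft> z \<triangleleft> w = rinv ?s" by (rule asc_cyc3[OF v z w])
  have "(?p \<triangleleft> x \<triangleleft> v \<otimes> ?s \<triangleleft> v) \<triangleleft> z \<triangleleft> w = (?s \<triangleleft> x \<triangleleft> v \<otimes> ?p \<triangleleft> x) \<triangleleft> z \<triangleleft> w"
    using asc_star[OF x v z w] by simp
  moreover have "?p \<triangleleft> x \<triangleleft> v \<triangleleft> z \<triangleleft> w = ?p \<triangleleft> x \<triangleleft> z \<triangleleft> w \<triangleleft> v"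
    using p x v z w by (simp add: act_commute[of _ v])
  moreover have "?s \<triangleleft> x \<triangleleft> v \<triangleleft> z \<triangleleft> w = ?s \<triangleleft> v \<triangleleft> z \<triangleleft> w \<triangleleft> x"
    using s x v z w by (simp add: act_commute[of _ x])
  ultimately have "rinv (?p \<triangleleft> v) \<otimes> rinv ?s = rinv (?s \<triangleleft> x) \<otimes> rinv ?p"
    using p s x v z w by (simp add: act_mult p1 s1 rinv_act)
  from arg_cong[OF this, of rinv] have "?p \<triangleleft> v \<otimes> ?s = ?s \<triangleleft> x \<otimes> ?p"
    using p s x v by (simp add: rinv_mult)
  then have "?p \<otimes> ?s \<triangleleft> x = ?p \<triangleleft> v \<otimes> ?s" using p s x v by (simp add: Z.m_comm)
  from Z_move[OF this] show ?thesis using p s x v by (simp add: D_def)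
qed

text \<open>
  \<open>asc_star\<close> says that \<open>([x,z,w] - [x,z,w] v) x = ([v,z,w] - [v,z,w] x) v\<close> in additive notation, and the two
  differences are equal by \<open>D_sym1\<close>.
\<close>

lemma D_act1: assumes x: "x \<in> carrier Q" and v: "v \<in> carrier Q" and z: "z \<in> carrier Q" and w: "w \<in> carrier Q"
  shows "D (asc x z w) v \<triangleleft> x = D (asc x z w) v \<triangleleft> v"
proof -
  let ?p = "asc x z w" and ?s = "asc v z w"
  have p: "?p \<in> ZN" and s: "?s \<in> ZN" using assms by auto
  have "?p \<triangleleft> x \<otimes> ?s \<triangleleft> v \<triangleleft> x = ?p \<triangleleft> x \<triangleleft> v \<otimes> ?s \<triangleleft> v"
    using asc_star[OF x v z w] act_commute[OF s x v] p s x v by (simp add: Z.m_comm)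
  from Z_move[OF this] have "D (?p \<triangleleft> x) v = D (?s \<triangleleft> v) x" using p s x v by (simp add: D_def)
  then show ?thesis using D_sym1[OF assms] p s x v by (simp add: D_act[symmetric])
qed

text \<open>
  \<open>D_act1\<close> for the cyclic rotations of the associator.
\<close>

lemma D_act23: assumes x: "x \<in> carrier Q" and v: "v \<in> carrier Q" and z: "z \<in> carrier Q" and w: "w \<in> carrier Q"
  shows "D (asc x z w) v \<triangleleft> z = D (asc x z w) v \<triangleleft> v" "D (asc x z w) v \<triangleleft> w = D (asc x z w) v \<triangleleft> v"
proof -
  let ?p = "asc x z w"
  have p: "?p \<in> ZN" using assms by auto
  let ?A = "D ?p v"
  have A: "?A \<in> ZN" using p v by simp
  have "rinv (?A \<triangleleft> x \<triangleleft> z) = rinv (?A \<triangleleft> x \<triangleleft> v)"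
    using D_act1[OF z v w x] asc_cyc[OF x z w] p x v z by (simp add: D_rinv rinv_act D_act)
  from arg_cong[OF this, of rinv] have "?A \<triangleleft> z \<triangleleft> x = ?A \<triangleleft> v \<triangleleft> x"
    using A x z v by (simp add: act_commute[OF A x])
  then show "?A \<triangleleft> z = ?A \<triangleleft> v" by (rule act_inj) (use A x z v in auto)
  have "?A \<triangleleft> x \<triangleleft> z \<triangleleft> w = ?A \<triangleleft> x \<triangleleft> z \<triangleleft> v"
    using D_act1[OF w v x z] asc_cyc2[OF x z w] p x v z w by (simp add: D_act)
  then have "?A \<triangleleft> w \<triangleleft> x \<triangleleft> z = ?A \<triangleleft> v \<triangleleft> x \<triangleleft> z"
    using A x z v w act_commute[of "?A \<triangleleft> x" z w] act_commute[of "?A \<triangleleft> x" z v] act_commute[of ?A x w] act_commute[of ?A x v]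
    by simp
  then have "?A \<triangleleft> w \<triangleleft> x = ?A \<triangleleft> v \<triangleleft> x" by (rule act_inj) (use A x z v w in auto)
  then show "?A \<triangleleft> w = ?A \<triangleleft> v" by (rule act_inj) (use A x z v w in auto)
qed

text \<open>
  Let \<open>p = [x,z,w]\<close> and \<open>A = p - p v\<close>. All of \<open>x, z, w\<close> act on \<open>A\<close> as \<open>v\<close> does, while \<open>x z w\<close> acts as \<open>-1\<close>; hence \<open>A v\<^sup>3 = - A\<close>. The
  same reasoning for the inverse of \<open>v\<close> concerns \<open>B = p - p v\<^sup>-\<^sup>1\<close>, for which \<open>B v = - A\<close>, and
  yields \<open>A v\<^sup>2 = A\<close>.
\<close>

lemma D_self: assumes x: "x \<in> carrier Q" and v: "v \<in> carrier Q" and z: "z \<in> carrier Q" and w: "w \<in> carrier Q"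
  shows "D (asc x z w) v \<triangleleft> v = rinv (D (asc x z w) v)"
proof -
  let ?p = "asc x z w" and ?V = "linv v"
  have p: "?p \<in> ZN" using assms by auto
  define A where "A = D ?p v"
  have A [simp]: "A \<in> ZN" using p v by (simp add: A_def)
  have Ax: "A \<triangleleft> x = A \<triangleleft> v" "A \<triangleleft> z = A \<triangleleft> v" "A \<triangleleft> w = A \<triangleleft> v"
    unfolding A_def using D_act1[OF assms] D_act23[OF assms] by auto
  have "rinv A = A \<triangleleft> x \<triangleleft> z \<triangleleft> w"
    unfolding A_def using p x z w v by (simp add: D_act asc_cyc3 D_rinv)
  also have "A \<triangleleft> x \<triangleleft> z \<triangleleft> w = A \<triangleleft> v \<triangleleft> z \<triangleleft> w" by (simp only: Ax)
  also have "\<dots> = A \<triangleleft> v \<triangleleft> v \<triangleleft> w" by (simp only: act_commute[OF A v z] Ax)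
  also have "\<dots> = A \<triangleleft> v \<triangleleft> w \<triangleleft> v" using v w by (intro act_commute) auto
  also have "\<dots> = A \<triangleleft> v \<triangleleft> v \<triangleleft> v" by (simp only: act_commute[OF A v w] Ax)
  finally have v3: "A \<triangleleft> v \<triangleleft> v \<triangleleft> v = rinv A" by (rule sym)
  have V: "?V \<in> carrier Q" using v by simp
  define B where "B = D ?p ?V"
  have B [simp]: "B \<in> ZN" using p V by (simp add: B_def)
  have Bv: "B \<triangleleft> v = rinv A"
    using p v by (simp add: A_def B_def D_def act_mult rinv_act act_linv rinv_mult Z.m_comm)
  have "B \<triangleleft> x = B \<triangleleft> ?V" unfolding B_def by (rule D_act1[OF x V z w])
  then have "B \<triangleleft> x \<triangleleft> v \<triangleleft> v = B \<triangleleft> v" using v by (simp add: act_linv)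
  moreover have "B \<triangleleft> x \<triangleleft> v \<triangleleft> v = rinv (A \<triangleleft> v \<triangleleft> v)"
    using v x by (simp only: act_commute[OF B x v] Bv rinv_act A ZN_act Ax)
  ultimately have "rinv (A \<triangleleft> v \<triangleleft> v) = rinv A" using Bv by simp
  from arg_cong[OF this, of rinv] have "A \<triangleleft> v \<triangleleft> v = A" using v by simp
  then show ?thesis using v3 by (simp add: A_def)
qed

lemma act_square: assumes x: "x \<in> carrier Q" and v: "v \<in> carrier Q" and z: "z \<in> carrier Q" and w: "w \<in> carrier Q"
  shows "asc x z w \<triangleleft> v \<triangleleft> v = asc x z w"
proof -
  let ?p = "asc x z w"
  have p: "?p \<in> ZN" using assms by auto
  have "?p \<triangleleft> v \<otimes> rinv (?p \<triangleleft> v \<triangleleft> v) = ?p \<triangleleft> v \<otimes> rinv ?p"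
    using D_self[OF assms] p v by (simp add: D_def act_mult rinv_act rinv_mult Z.m_comm)
  then have "rinv (?p \<triangleleft> v \<triangleleft> v) = rinv ?p" by (rule Z_cancel) (use p v in auto)
  from arg_cong[OF this, of rinv] show ?thesis using p v by simp
qed

text \<open>
  Additively this is \<open>p (1 - v) (1 + t) = 0\<close> for \<open>p = [x,z,w]\<close>: the element \<open>p (1 - v)\<close> is negated by \<open>v\<close>,
  and \<open>t\<close> acts on it as \<open>v\<close> does.
\<close>

lemma asc_anti: assumes x: "x \<in> carrier Q" and v: "v \<in> carrier Q" and z: "z \<in> carrier Q" and w: "w \<in> carrier Q"
    and t: "t \<in> {x, z, w}"
  shows "asc x z w \<otimes> asc x z w \<triangleleft> t = asc x z w \<triangleleft> v \<otimes> asc x z w \<triangleleft> v \<triangleleft> t"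
proof -
  let ?p = "asc x z w"
  have p: "?p \<in> ZN" and tC: "t \<in> carrier Q" using assms by auto
  have "D ?p v \<triangleleft> t = rinv (D ?p v)"
    using D_act1[OF x v z w] D_act23[OF x v z w] D_self[OF x v z w] t by auto
  then have "?p \<triangleleft> t \<otimes> rinv (?p \<triangleleft> v \<triangleleft> t) = ?p \<triangleleft> v \<otimes> rinv ?p"
    using p v tC by (simp add: D_def act_mult rinv_act rinv_mult Z.m_comm)
  from Z_move[OF this] have "?p \<triangleleft> t \<otimes> rinv (?p \<triangleleft> v) = rinv ?p \<otimes> ?p \<triangleleft> v \<triangleleft> t"
    using p v tC by simp
  from Z_move[OF this] show ?thesis using p v tC by (simp add: Z.m_comm)
qed

section \<open>Squares, inverses and reversed arguments\<close>

text \<open>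
  The products \<open>z w\<close> and \<open>w z\<close> differ by a nuclear commutator, which the third slot ignores; so the two expansions of
  \<open>[x,y,z w]\<close> and \<open>[x,y,w z]\<close> agree.
\<close>

lemma D_sym3: assumes x: "x \<in> carrier Q" and y: "y \<in> carrier Q" and z: "z \<in> carrier Q" and w: "w \<in> carrier Q"
  shows "D (asc x y z) w = D (asc x y w) z"
proof -
  let ?k = "ldiv Q (w \<otimes> z) (z \<otimes> w)"
  have k: "?k \<in> N" by (rule commutator_nuclear[OF z w])
  have "asc x y z \<triangleleft> w \<otimes> asc x y w = asc x y ((w \<otimes> z) \<otimes> ?k)"
    using associator_mult_right[OF x y z w] w z by simp
  also have "\<dots> = asc x y w \<triangleleft> z \<otimes> asc x y z"
    using associator_mult_right[OF x y, of "w \<otimes> z" ?k] associator_mult_right[OF x y w z] assms k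
      asc_N3[OF x y k] act_N[of "asc x y (w \<otimes> z)" ?k] by simp
  finally have "asc x y z \<otimes> asc x y w \<triangleleft> z = asc x y z \<triangleleft> w \<otimes> asc x y w"
    using assms by (simp add: Z.m_comm)
  from Z_move[OF this] show ?thesis using assms by (simp add: D_def)
qed

lemma asc_square: assumes "x \<in> carrier Q" "y \<in> carrier Q" "z \<in> carrier Q"
  shows "asc (x \<otimes> x) y z = asc x y z \<otimes> asc x y z \<triangleleft> x"
proof -
  have "asc (x \<otimes> x) y z = asc (x \<otimes> x) y z \<triangleleft> x \<triangleleft> x" using assms by (simp add: act_square)
  also have "\<dots> = asc x y z \<otimes> asc x y z \<triangleleft> x" using assms by (simp add: asc_mult1 act_mult act_square)
  finally show ?thesis .
qed

lemma asc_one2: "\<lbrakk>x \<in> carrier Q; z \<in> carrier Q\<rbrakk> \<Longrightarrow> asc x \<one> z = \<one>"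
  by (simp add: associator_def)

text \<open>
  The second-slot rule for the product \<open>\<one>\<close> of \<open>y\<close> and \<open>y'\<close>, in whichever order that product is known to be trivial.
\<close>

lemma asc_inverse2: assumes x: "x \<in> carrier Q" and y: "y \<in> carrier Q" and z: "z \<in> carrier Q"
    and y': "one_sided_inverse Q y y'"
  shows "asc x y' z = rinv (asc x y z \<triangleleft> y)"
proof -
  have C: "y' \<in> carrier Q" using y' by (simp add: one_sided_inverse_def)
  have "asc x y z \<triangleleft> y \<otimes> asc x y' z = \<one>"
  proof (cases "y \<otimes> y' = \<one>")
    case True
    have "asc x y z \<triangleleft> x \<triangleleft> y \<otimes> asc x y' z \<triangleleft> x = \<one>"
      using asc_mult2[OF x y C z] x y z True by (simp add: asc_one2)
    then have "(asc x y z \<triangleleft> y \<otimes> asc x y' z) \<triangleleft> x = \<one> \<triangleleft> x"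
      using act_commute[of "asc x y z" x y] x y z C by (simp add: act_mult)
    then show ?thesis by (rule act_inj) (use x y z C in auto)
  next
    case False
    then have e: "y' \<otimes> y = \<one>" using y' by (simp add: one_sided_inverse_def)
    have "asc x y' z \<triangleleft> x \<triangleleft> y' \<otimes> asc x y z \<triangleleft> x = \<one>"
      using asc_mult2[OF x C y z] x y z C e by (simp add: asc_one2)
    then have "(asc x y' z \<triangleleft> y' \<otimes> asc x y z) \<triangleleft> x = \<one> \<triangleleft> x"
      using act_commute[of "asc x y' z" x y'] x y z C by (simp add: act_mult)
    then have "asc x y' z \<triangleleft> y' \<otimes> asc x y z = \<one>" by (rule act_inj) (use x y z C in auto)
    from arg_cong[OF this, of "\<lambda>a. a \<triangleleft> y"] have "asc x y' z \<triangleleft> (y' \<otimes> y) \<otimes> asc x y z \<triangleleft> y = \<one>"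
      using x y z C by (simp add: act_mult act_act del: act_one)
    then show ?thesis using x y z C e by (simp add: Z.m_comm)
  qed
  then show ?thesis using x y z C by (intro rinv_eqI[symmetric]) auto
qed

text \<open>
  Let \<open>d = [x,y,z] - [z,y,x]\<close> in additive notation. Exchanging arguments by \<open>D_sym1\<close> and \<open>D_sym3\<close> shows that
  \<open>d\<close> is fixed by every element of \<open>Q\<close>. But \<open>x y z\<close> inverts both associators, so \<open>d = - d\<close>, and
  therefore \<open>d + d z = 2 d = 0\<close>.
\<close>

lemma asc_reverse: assumes x: "x \<in> carrier Q" and y: "y \<in> carrier Q" and z: "z \<in> carrier Q"
  shows "asc z y x \<otimes> asc z y x \<triangleleft> z = asc x y z \<otimes> asc x y z \<triangleleft> z"
proof -
  define p e d where "p = asc x y z" and "e = asc z y x" and "d = p \<otimes> rinv e"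
  have Z [simp]: "p \<in> ZN" "e \<in> ZN" "d \<in> ZN" using assms by (simp_all add: p_def e_def d_def)
  have dv: "d \<triangleleft> v = d" if v: "v \<in> carrier Q" for v
  proof -
    have "D p v = D e v" unfolding p_def e_def
      using D_sym1[OF x v y z] D_sym3[OF v y z x] D_sym1[OF z v y x] by simp
    then have "p \<otimes> rinv (p \<triangleleft> v) = e \<otimes> rinv (e \<triangleleft> v)" by (simp add: D_def)
    from Z_move[OF this] have k: "p \<otimes> rinv e = p \<triangleleft> v \<otimes> rinv (e \<triangleleft> v)" using v by (simp add: Z.m_comm)
    have "d \<triangleleft> v = p \<triangleleft> v \<otimes> rinv (e \<triangleleft> v)" using v by (simp add: d_def act_mult rinv_act)
    then show ?thesis by (simp only: k[symmetric] d_def)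
  qed
  have "e \<triangleleft> z \<triangleleft> y \<triangleleft> x = rinv e" unfolding e_def by (rule asc_cyc3[OF z y x])
  moreover have "e \<triangleleft> z \<triangleleft> y \<triangleleft> x = e \<triangleleft> x \<triangleleft> y \<triangleleft> z"
    using x y z by (simp add: act_commute[of e z] act_commute[of "e \<triangleleft> y" z x] act_commute[of e y x])
  ultimately have "d \<triangleleft> x \<triangleleft> y \<triangleleft> z = rinv p \<otimes> e"
    using asc_cyc3[OF x y z] x y z by (simp add: d_def act_mult rinv_act p_def[symmetric])
  then have d: "d = rinv p \<otimes> e" using x y z by (simp add: dv)
  have "(p \<otimes> p \<triangleleft> z) \<otimes> rinv (e \<otimes> e \<triangleleft> z) = d \<otimes> d \<triangleleft> z"
    using z by (simp add: d_def act_mult rinv_act rinv_mult Z.m_ac)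
  also have "\<dots> = d \<otimes> (rinv p \<otimes> e)" by (simp only: trans[OF dv[OF z] d])
  also have "\<dots> = (p \<otimes> rinv p) \<otimes> (e \<otimes> rinv e)" by (simp only: d_def Z.m_ac Z ZN_rinv ZN_mult)
  also have "\<dots> = (e \<otimes> e \<triangleleft> z) \<otimes> rinv (e \<otimes> e \<triangleleft> z)" using z by simp
  finally have "(p \<otimes> p \<triangleleft> z) \<otimes> rinv (e \<otimes> e \<triangleleft> z) = (e \<otimes> e \<triangleleft> z) \<otimes> rinv (e \<otimes> e \<triangleleft> z)" .
  from r_cancel[OF this] have "p \<otimes> p \<triangleleft> z = e \<otimes> e \<triangleleft> z" using z by simp
  then show ?thesis by (simp only: p_def e_def)
qed

section \<open>The linear relations for the associator with an inverse in the middle\<close>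

lemma inv_eq_rinv: assumes "n \<in> N" shows "m_inv Q n = rinv n"
  unfolding m_inv_def
proof (rule the_equality)
  show "rinv n \<in> carrier Q \<and> n \<otimes> rinv n = \<one> \<and> rinv n \<otimes> n = \<one>" using assms by simp
  fix y assume "y \<in> carrier Q \<and> n \<otimes> y = \<one> \<and> y \<otimes> n = \<one>"
  then show "y = rinv n" using assms ldiv_mult[of n y] by simp
qed

lemma square_eq: assumes "b \<otimes> rinv c = c \<otimes> rinv b" "b \<in> ZN" "c \<in> ZN" shows "b \<otimes> b = c \<otimes> c"
proof -
  have "b \<otimes> b = (b \<otimes> b) \<otimes> (c \<otimes> rinv c)" using assms(2,3) by simp
  also have "\<dots> = (b \<otimes> rinv c) \<otimes> (c \<otimes> b)" using assms(2,3) by (simp only: Z.m_ac ZN_rinv ZN_mult)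
  also have "\<dots> = (c \<otimes> rinv b) \<otimes> (c \<otimes> b)" by (simp only: assms(1))
  also have "\<dots> = (c \<otimes> c) \<otimes> (b \<otimes> rinv b)" using assms(2,3) by (simp only: Z.m_ac ZN_rinv ZN_mult)
  also have "\<dots> = c \<otimes> c" using assms(2,3) by simp
  finally show ?thesis .
qed

text \<open>
  With \<open>a, b, c, d\<close> for \<open>[x,y,z]\<close> and its images under \<open>x, y, z\<close>, each of \<open>x\<close>, \<open>y\<close>, \<open>z\<close> permutes
  \<open>a, b, c, d\<close> up to sign, and the ten identities reduce to the relations \<open>a + b = c - d = d - c\<close>,
  \<open>a + c = b - d = d - b\<close>, \<open>a + d = b - c = c - b\<close>, in additive notation.
\<close>

theorem associator_squares:
  fixes x y z y' u
  assumes x: "x \<in> carrier Q" and y: "y \<in> carrier Q" and z: "z \<in> carrier Q"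
    and y': "one_sided_inverse Q y y'"
    and u: "u = asc x y' z"
  shows "asc (x \<otimes> x) y z = u \<triangleleft> x \<otimes> u" (is ?g1)
    "asc (y \<otimes> y) z x = u \<triangleleft> y \<otimes> u" (is ?g2)
    "asc (z \<otimes> z) y x = u \<triangleleft> z \<otimes> u" (is ?g3)
    "asc (x \<otimes> x) y z \<otimes> asc (y \<otimes> y) z x \<otimes> asc (z \<otimes> z) y x = \<one>" (is ?g4)
    "u \<triangleleft> x \<otimes> u \<triangleleft> y \<otimes> u \<triangleleft> z = u [^] (-3 :: int)" (is ?g5)
    "u \<triangleleft> (x \<otimes> y \<otimes> z) = inv u" (is ?g6)
    "u \<triangleleft> (x \<otimes> (y \<otimes> z)) = inv u" (is ?g7)
    "(u [^] (2 :: nat)) \<triangleleft> x = u [^] (-2 :: int)" (is ?g8)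
    "(u [^] (2 :: nat)) \<triangleleft> y = u [^] (-2 :: int)" (is ?g9)
    "(u [^] (2 :: nat)) \<triangleleft> z = u [^] (-2 :: int)" (is ?g10)
proof -
  define a b c d where "a = asc x y z" and "b = asc x y z \<triangleleft> x" and "c = asc x y z \<triangleleft> y" and "d = asc x y z \<triangleleft> z"
  note defs = this
  have Z [simp]: "a \<in> ZN" "b \<in> ZN" "c \<in> ZN" "d \<in> ZN" using x y z by (simp_all add: defs)
  have bcd: "a \<triangleleft> x = b" "a \<triangleleft> y = c" "a \<triangleleft> z = d" by (simp_all add: defs)
  have sq: "a \<triangleleft> v \<triangleleft> v = a" if "v \<in> carrier Q" for v using act_square[OF x that y z] by (simp add: a_def)
  have a3: "a \<triangleleft> x \<triangleleft> y \<triangleleft> z = rinv a" unfolding a_def by (rule asc_cyc3[OF x y z])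
  have xy: "b \<triangleleft> y = rinv d" "c \<triangleleft> x = rinv d"
  proof -
    have "b \<triangleleft> y = a \<triangleleft> z \<triangleleft> z \<triangleleft> x \<triangleleft> y" using sq[OF z] bcd by simp
    also have "\<dots> = a \<triangleleft> z \<triangleleft> x \<triangleleft> y \<triangleleft> z"
      using x y z by (simp add: act_commute[of "a \<triangleleft> z" z x] act_commute[of "a \<triangleleft> z \<triangleleft> x" z y])
    also have "\<dots> = a \<triangleleft> x \<triangleleft> y \<triangleleft> z \<triangleleft> z"
      using x y z by (simp add: act_commute[of a z x] act_commute[of "a \<triangleleft> x" z y])
    also have "\<dots> = rinv d" unfolding a3 using z by (simp add: rinv_act bcd)
    finally show "b \<triangleleft> y = rinv d" .
    then show "c \<triangleleft> x = rinv d" using act_commute[of a x y] x y bcd by simp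
  qed
  have xz: "b \<triangleleft> z = rinv c" "d \<triangleleft> x = rinv c"
  proof -
    have "b \<triangleleft> z = a \<triangleleft> y \<triangleleft> y \<triangleleft> x \<triangleleft> z" using sq[OF y] bcd by simp
    also have "\<dots> = a \<triangleleft> x \<triangleleft> y \<triangleleft> z \<triangleleft> y"
      using x y z by (simp add: act_commute[of "a \<triangleleft> y" y x] act_commute[of a y x] act_commute[of "a \<triangleleft> x \<triangleleft> y" y z])
    also have "\<dots> = rinv c" unfolding a3 using y by (simp add: rinv_act bcd)
    finally show "b \<triangleleft> z = rinv c" .
    then show "d \<triangleleft> x = rinv c" using act_commute[of a x z] x z bcd by simp
  qed
  have yz: "c \<triangleleft> z = rinv b" "d \<triangleleft> y = rinv b"
  proof -
    have "c \<triangleleft> z = a \<triangleleft> x \<triangleleft> x \<triangleleft> y \<triangleleft> z" using sq[OF x] bcd by simp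
    also have "\<dots> = a \<triangleleft> x \<triangleleft> y \<triangleleft> z \<triangleleft> x"
      using x y z by (simp add: act_commute[of "a \<triangleleft> x" x y] act_commute[of "a \<triangleleft> x \<triangleleft> y" x z])
    also have "\<dots> = rinv b" unfolding a3 using x by (simp add: rinv_act bcd)
    finally show "c \<triangleleft> z = rinv b" .
    then show "d \<triangleleft> y = rinv b" using act_commute[of a y z] y z bcd by simp
  qed
  note an = asc_anti[OF x _ y z, folded a_def]
  have ab: "a \<otimes> b = c \<otimes> rinv d" "a \<otimes> b = d \<otimes> rinv c"
    using an[OF y, of x] an[OF z, of x] by (simp_all add: bcd xy xz)
  have ac: "a \<otimes> c = b \<otimes> rinv d" "a \<otimes> c = d \<otimes> rinv b"
    using an[OF x, of y] an[OF z, of y] by (simp_all add: bcd xy yz)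
  have ad: "a \<otimes> d = b \<otimes> rinv c" "a \<otimes> d = c \<otimes> rinv b"
    using an[OF x, of z] an[OF y, of z] by (simp_all add: bcd xz yz)
  have bb: "b \<otimes> b = c \<otimes> c" by (rule square_eq) (use ad in auto)
  have dd: "d \<otimes> d = c \<otimes> c" by (rule square_eq) (use ab in auto)
  have uc: "u = rinv c" unfolding u c_def by (rule asc_inverse2[OF x y z y'])
  have ux: "u \<triangleleft> x = d" and uy: "u \<triangleleft> y = rinv a" and uz: "u \<triangleleft> z = b"
    using x y z sq[OF y] by (simp_all add: uc rinv_act xy yz bcd)
  have s1: "asc (x \<otimes> x) y z = a \<otimes> b" using asc_square[OF x y z] by (simp add: defs)
  have fyzx: "asc y z x = rinv b" using asc_cyc[OF x y z] by (simp add: defs)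
  have s2: "asc (y \<otimes> y) z x = rinv b \<otimes> d" using asc_square[OF y z x] y by (simp add: fyzx rinv_act xy)
  have s3: "asc (z \<otimes> z) y x = a \<otimes> d" using asc_square[OF z y x] asc_reverse[OF x y z] by (simp add: defs)
  show ?g1 unfolding s1 ux using ab(2) by (simp add: uc)
  show ?g2
  proof -
    have "rinv (a \<otimes> c) = rinv (b \<otimes> rinv d)" by (simp only: ac(1))
    then show ?thesis unfolding s2 uy by (simp add: uc rinv_mult)
  qed
  show ?g3 unfolding s3 uz using ad(1) by (simp add: uc)
  show ?g4
  proof -
    have "(a \<otimes> b) \<otimes> (rinv b \<otimes> d) \<otimes> (a \<otimes> d) = (b \<otimes> rinv b) \<otimes> ((a \<otimes> d) \<otimes> (a \<otimes> d))"
      by (simp only: Z.m_ac Z ZN_rinv ZN_mult)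
    also have "(a \<otimes> d) \<otimes> (a \<otimes> d) = (b \<otimes> rinv c) \<otimes> (c \<otimes> rinv b)" by (simp only: ad[symmetric])
    also have "\<dots> = (b \<otimes> rinv b) \<otimes> (c \<otimes> rinv c)" by (simp only: Z.m_ac Z ZN_rinv ZN_mult)
    finally show ?thesis by (simp add: s1 s2 s3)
  qed
  have p3: "u [^] (-3 :: int) = c \<otimes> c \<otimes> c"
    by (simp add: int_pow_def nat_pow_def numeral_eq_Suc inv_eq_rinv uc rinv_mult)
  have p2: "u [^] (-2 :: int) = c \<otimes> c" and p2': "u [^] (2 :: nat) = u \<otimes> u"
    by (simp_all add: int_pow_def nat_pow_def numeral_eq_Suc inv_eq_rinv uc rinv_mult)
  show ?g5
  proof -
    have "c \<otimes> (u \<triangleleft> x \<otimes> u \<triangleleft> y \<otimes> u \<triangleleft> z) = rinv a \<otimes> (c \<otimes> (d \<otimes> b))"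
      unfolding ux uy uz by (simp only: Z.m_ac Z ZN_rinv ZN_mult)
    also have "d \<otimes> b = d \<otimes> (rinv c \<otimes> c) \<otimes> b" by simp
    also have "\<dots> = (d \<otimes> rinv c) \<otimes> (b \<otimes> c)" by (simp only: Z.m_ac Z ZN_rinv ZN_mult)
    also have "\<dots> = (a \<otimes> b) \<otimes> (b \<otimes> c)" by (simp only: ab(2))
    also have "rinv a \<otimes> (c \<otimes> ((a \<otimes> b) \<otimes> (b \<otimes> c))) = (rinv a \<otimes> a) \<otimes> (c \<otimes> ((b \<otimes> b) \<otimes> c))"
      by (simp only: Z.m_ac Z ZN_rinv ZN_mult)
    also have "\<dots> = c \<otimes> (c \<otimes> c \<otimes> c)" by (simp add: bb)
    finally show ?thesis unfolding p3 by (rule Z_cancel) (use x y z uc in auto)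
  qed
  have uN: "u \<in> N" by (simp add: uc)
  have invu: "inv u = c" by (simp add: uc inv_eq_rinv)
  have u3: "u \<triangleleft> x \<triangleleft> y \<triangleleft> z = c"
    unfolding ux yz using z by (simp add: xz rinv_act)
  show ?g6 ?g7 using u3 x y z uN by (simp_all add: act_act invu N_conj)
  show ?g8 unfolding p2 p2' using x uN by (simp add: act_mult ux dd)
  show ?g9
  proof -
    have "(a \<otimes> a) \<otimes> (c \<otimes> c) = (a \<otimes> c) \<otimes> (a \<otimes> c)" by (simp only: Z.m_ac Z ZN_rinv ZN_mult)
    also have "\<dots> = (b \<otimes> rinv d) \<otimes> (d \<otimes> rinv b)" by (simp only: ac[symmetric])
    also have "\<dots> = (b \<otimes> rinv b) \<otimes> (d \<otimes> rinv d)" by (simp only: Z.m_ac Z ZN_rinv ZN_mult)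
    also have "\<dots> = \<one>" by simp
    finally have "rinv (a \<otimes> a) = c \<otimes> c" by (intro rinv_eqI) auto
    then show ?thesis unfolding p2 p2' using y uN by (simp add: act_mult uy rinv_mult)
  qed
  show ?g10 unfolding p2 p2' using z uN by (simp add: act_mult uz bb)
qed

end

theorem proposition1p3:
  fixes Q :: "('a, 'b) monoid_scheme" (structure)
    and x y z y' u s\<^sub>x s\<^sub>y s\<^sub>z :: 'a
  assumes "buchsteiner_loop Q"
    and "x \<in> carrier Q" and "y \<in> carrier Q" and "z \<in> carrier Q"
    and "one_sided_inverse Q y y'"
    and "u = associator Q x y' z"
    and "s\<^sub>x = associator Q (x \<otimes> x) y z"
    and "s\<^sub>y = associator Q (y \<otimes> y) z x"
    and "s\<^sub>z = associator Q (z \<otimes> z) y x"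
  shows "s\<^sub>x = conj_by Q u x \<otimes> u \<and> s\<^sub>y = conj_by Q u y \<otimes> u \<and> s\<^sub>z = conj_by Q u z \<otimes> u
    \<and> s\<^sub>x \<otimes> s\<^sub>y \<otimes> s\<^sub>z = \<one>
    \<and> conj_by Q u x \<otimes> conj_by Q u y \<otimes> conj_by Q u z = u [^] (-3 :: int)
    \<and> conj_by Q u (x \<otimes> y \<otimes> z) = inv u
    \<and> conj_by Q u (x \<otimes> (y \<otimes> z)) = inv u
    \<and> conj_by Q (u [^] (2 :: nat)) x = u [^] (-2 :: int)
    \<and> conj_by Q (u [^] (2 :: nat)) y = u [^] (-2 :: int)
    \<and> conj_by Q (u [^] (2 :: nat)) z = u [^] (-2 :: int)"
proof -
  interpret buchsteiner_loop Q by fact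
  show ?thesis
    unfolding assms(7-9) by (intro conjI associator_squares[OF assms(2-6)])
qed

end
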